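(* Let $L>2$, $B\in[1,\infty]$, $M>0$, and let $\mathcal W=\mathrm{Lip}(L,B)$. The empirical risk minimizer $\hat G_n\in\arg\min_{G\in\mathcal G}\mathsf V_{\mathcal W}(\mathbb P_n,\mathbb P^{G(Z)})$ satisfies $$\mathbb E\big[\mathsf W_1(\mathbb P^*,\mathbb P^{\hat G_n(Z)})\big]\le\inf_{G^*\in\mathrm{Lip}(M,\mathcal Z)}\Big\{c\,\big[\mathsf W_1(\mathbb P^*,\mathbb P^{G^*(Z)})\big]^{1;1/2}+c\,\big[\inf_{G\in\mathcal G}\|G-G^*\|_\infty\big]^{1;1/2}\Big\}+c\,r_n,$$ where $$r_n=\begin{cases}n^{-1/(2d^* )},&d^*>2,\\ n^{-1/4}(\log n)^{1/2},&d^*=2,\\ n^{-1/4},&d^*=1,\end{cases}$$ for some constant $c$ depending on $d^*,d,p,L$ and $M$.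
   Context: Fix $d,d^*\in\mathbb N$ and $p\in[1,\infty]$; $\mathbb R^d$ and $\mathbb R^{d^*}$ carry the $\ell_p$-norm $|\cdot|_p$. Let $\mathcal X=(0,1)^d$ and $\mathcal Z=(0,1)^{d^*}$ (latent space). $\mathbb P^*$ is a probability measure on $\mathcal X$, $\mathbb U$ a probability measure on $\mathcal Z$ (both with finite first moment), $Z\sim\mathbb U$. $X_1,\dots,X_n$ are i.i.d. with law $\mathbb P^*$ and $\mathbb P_n$ is their empirical distribution. $\mathcal G$ is a nonempty set of measurable functions $\mathcal Z\to\mathcal X$, compact with respect to the supremum norm (standing assumption of the paper); $\mathbb P^{G(Z)}$ is the law of $G(Z)$, where for the data-dependent $\hat G_n$ the law is taken over $Z$ with the sample fixed; the outer expectation is over the sample. $\mathrm{Lip}(L,B)$ is the set of $f:\mathcal X\to\mathbb R$ with $\|f\|_\infty\le B$ and $|f(x)-f(y)|\le L|x-y|_p$ for all $x,y\in\mathcal X$; $\mathrm{Lip}(L)=\mathrm{Lip}(L,\infty)$. $\mathrm{Lip}(M,\mathcal Z)$, as a class of maps $G^*$, is the set of $G^*:\mathcal Z\to\mathcal X$ with $|G^*(x)-G^*(y)|_p\le M|x-y|_p$ for all $x,y\in\mathcal Z$. $\|G-G^*\|_\infty=\sup_{z\in\mathcal Z}|G(z)-G^*(z)|_p$. For a set $\mathcal W$ of measurable functions $\mathcal X\to\mathbb R$, $$\mathsf V_{\mathcal W}(\mathbb P,\mathbb Q)=\sup_{W\in\mathcal W}\mathbb E_{X\sim\mathbb P,\,Y\sim\mathbb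 Q}\Big[-\log\Big(\frac{1+e^{-W(X)}}2\Big)-\log\Big(\frac{1+e^{W(Y)}}2\Big)\Big].$$ $\mathsf W_1(\mathbb P,\mathbb Q)=\sup_{W\in\mathrm{Lip}(1)}\mathbb E_{X\sim\mathbb P,\,Y\sim\mathbb Q}[W(X)-W(Y)]$. For $x\ge0$, $[x]^{1;1/2}=\max\{x,\sqrt x\}$.
   Formalization: For d*=2 the sample size is taken to be n≥2, since at n=1 the rate r_n is 0 and the inequality can fail; n≥1 and measurability of the estimator's W_1 risk in the sample are made explicit. *)

theory Defs
  imports "HOL-Probability.Probability"
begin

text \<open>
  The data space and the latent space are open unit cubes, in \<open>real^'d\<close> and \<open>real^'s\<close>, so that
  \<open>d = CARD('d)\<close> and \<open>d\<^sup>* = CARD('s)\<close>. Exponents and bounds in \<open>[1,\<infinity>]\<close> are extended reals.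
\<close>

abbreviation unit_box :: "(real^'n::finite) set" where
  "unit_box \<equiv> box 0 1"

abbreviation cube_borel :: "(real^'n::finite) measure" where
  "cube_borel \<equiv> restrict_space borel unit_box"

definition lp_norm :: "ereal \<Rightarrow> real^'n::finite \<Rightarrow> real" where
  "lp_norm p x =
     (if p = \<infinity> then infnorm x
      else (\<Sum>i\<in>UNIV. \<bar>x $ i\<bar> powr real_of_ereal p) powr (1 / real_of_ereal p))"

definition prob_on_cube :: "ereal \<Rightarrow> (real^'n::finite) measure \<Rightarrow> bool" where
  "prob_on_cube p P \<longleftrightarrow>
     prob_space P \<and> sets P = sets cube_borel \<and> integrable P (lp_norm p)"

text \<open>
  Real-valued functions are constrained on the cube only; all measures below live on the cube, so
  their values elsewhere are irrelevant.
\<close>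

definition lip_fun :: "ereal \<Rightarrow> real \<Rightarrow> ereal \<Rightarrow> (real^'d::finite \<Rightarrow> real) set" where
  "lip_fun p L B =
     {f. (\<forall>x\<in>unit_box. ereal \<bar>f x\<bar> \<le> B) \<and>
         (\<forall>x\<in>unit_box. \<forall>y\<in>unit_box. \<bar>f x - f y\<bar> \<le> L * lp_norm p (x - y))}"

text \<open>
  Maps from the latent cube to the data cube are taken extensional, so that the supremum distance
  separates them.
\<close>

definition meas_maps :: "(real^'s::finite \<Rightarrow> real^'d::finite) set" where
  "meas_maps = (unit_box \<rightarrow>\<^sub>E unit_box) \<inter> (cube_borel \<rightarrow>\<^sub>M cube_borel)"

definition lip_maps :: "ereal \<Rightarrow> real \<Rightarrow> (real^'s::finite \<Rightarrow> real^'d::finite) set" where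
  "lip_maps p M =
     {G \<in> unit_box \<rightarrow>\<^sub>E unit_box.
        \<forall>x\<in>unit_box. \<forall>y\<in>unit_box. lp_norm p (G x - G y) \<le> M * lp_norm p (x - y)}"

definition sup_dist ::
    "ereal \<Rightarrow> (real^'s::finite \<Rightarrow> real^'d::finite) \<Rightarrow> (real^'s \<Rightarrow> real^'d) \<Rightarrow> real" where
  "sup_dist p G H = (SUP z\<in>unit_box. lp_norm p (G z - H z))"

definition sup_compact :: "ereal \<Rightarrow> (real^'s::finite \<Rightarrow> real^'d::finite) set \<Rightarrow> bool" where
  "sup_compact p \<G> \<longleftrightarrow> compactin (Metric_space.mtopology meas_maps (sup_dist p)) \<G>"

definition gen_law ::
    "(real^'s::finite) measure \<Rightarrow> (real^'s \<Rightarrow> real^'d::finite) \<Rightarrow> (real^'d) measure" where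
  "gen_law U G = distr U cube_borel G"

definition empirical :: "nat \<Rightarrow> (nat \<Rightarrow> real^'d::finite) \<Rightarrow> (real^'d) measure" where
  "empirical n x = distr (uniform_count_measure {..<n}) cube_borel x"

text \<open>
  In the next two definitions only the marginals of the joint law matter, as the integrand is a
  sum of a function of \<open>x\<close> and a function of \<open>y\<close>. Both suprema are finite for the classes used:
  the integrand is at most \<open>2 * ln 2\<close> in the first, and at most the diameter of the cube in the
  second.
\<close>

definition gan_val ::
    "(real^'d::finite \<Rightarrow> real) set \<Rightarrow> (real^'d) measure \<Rightarrow> (real^'d) measure \<Rightarrow> real" where
  "gan_val \<W> P Q =
     (SUP W\<in>\<W>. \<integral>(x, y). - ln ((1 + exp (- W x)) / 2) - ln ((1 + exp (W y)) / 2) \<partial>(P \<Otimes>\<^sub>M Q))"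

definition wass1 :: "ereal \<Rightarrow> (real^'d::finite) measure \<Rightarrow> (real^'d) measure \<Rightarrow> real" where
  "wass1 p P Q = (SUP W\<in>lip_fun p 1 \<infinity>. \<integral>(x, y). W x - W y \<partial>(P \<Otimes>\<^sub>M Q))"

definition bracket :: "real \<Rightarrow> real" where
  "bracket x = max x (sqrt x)"

definition rate :: "nat \<Rightarrow> nat \<Rightarrow> real" where
  "rate ds n =
     (if ds > 2 then real n powr (- 1 / (2 * real ds))
      else if ds = 2 then real n powr (- 1 / 4) * sqrt (ln (real n))
      else real n powr (- 1 / 4))"

definition is_erm ::
    "(real^'d::finite \<Rightarrow> real) set \<Rightarrow> (real^'s::finite \<Rightarrow> real^'d) set \<Rightarrow>
     (real^'d) measure \<Rightarrow> (real^'s) measure \<Rightarrow> nat \<Rightarrow>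
     ((nat \<Rightarrow> real^'d) \<Rightarrow> real^'s \<Rightarrow> real^'d) \<Rightarrow> bool" where
  "is_erm \<W> \<G> P U n Gh \<longleftrightarrow>
     (\<forall>x \<in> space (\<Pi>\<^sub>M i\<in>{..<n}. P).
        is_arg_min (\<lambda>G. gan_val \<W> (empirical n x) (gen_law U G)) (\<lambda>G. G \<in> \<G>) (Gh x))"

end

theory Submission
  imports Defs
begin

text \<open>
  The GAN value and the Wasserstein distance control each other: \<open>W\<^sub>1\<^sup>2 / (4 d\<^sup>2) \<le> V \<le> L W\<^sub>1\<close>. Hence,
  through the empirical measure and the optimality of the minimiser, \<open>W\<^sub>1\<close> between \<open>P\<close> and the
  learned law is at most a constant times the square root of
  \<open>W\<^sub>1(P, P\<^sub>n) + W\<^sub>1(P, law of G\<^sup>*) + \<parallel>G - G\<^sup>*\<parallel>\<close>. The dimension of the data would enter through the first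
  summand; it is replaced by the latent dimension by chaining over the images under \<open>G\<^sup>*\<close> of dyadic
  grids of the latent cube. The mean distance of \<open>P\<close> from such an image is at most \<open>W\<^sub>1(P, law of G\<^sup>*)\<close>
  plus the mesh, because the distance function is a 1-Lipschitz test function.
\<close>

section \<open>The norm and the two distances\<close>

text \<open>The halved exponents come from the GAN value. A small test function gains linearly in
  its scale but loses quadratically, because the log-logistic integrand has curvature at 0; the best
  scale leaves a lower bound quadratic in \<open>wass1\<close>, so every error returns under a
  square root. Hence chaining has to deliver \<open>(rate CARD('s) n)\<^sup>2\<close>.

  The supremum over test functions does not commute with the expectation over the sample. Chaining
  replaces it by an explicit integrable majorant \<open>T\<close>, a finite combination of cell
  frequencies and averages. The expectation passes through the root by a tangent line touching at a
  deterministic bound for the mean. Both infima stay outside: every estimate is for fixed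
  \<open>G\<close> and \<open>Gs\<close>, with a constant free of both, and the infima are formed at
  the very end.\<close>

lemma lp_norm_nonneg: "0 \<le> lp_norm p x"
  by (simp add: lp_norm_def infnorm_pos_le)

lemma infnorm_cart_le:
  assumes "\<And>i. \<bar>x $ i\<bar> \<le> c"
  shows "infnorm (x :: real^'n::finite) \<le> c"
  unfolding infnorm_cart using assms by (intro cSup_least) auto

lemma ereal_one_le_cases:
  assumes "1 \<le> (p :: ereal)"
  obtains "p = \<infinity>" | r where "p = ereal r" "1 \<le> r"
  using assms by (cases p) auto

text \<open>With the reverse bound \<open>lp_norm_le_infnorm\<close>, the exponent is absorbed into
  factors equal to a dimension. Mesh estimates can then be made coordinate by coordinate in
  \<open>infnorm\<close>.\<close>

lemma infnorm_le_lp_norm: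
  assumes "1 \<le> p"
  shows "infnorm (x :: real^'n::finite) \<le> lp_norm p x"
  using assms
proof (cases rule: ereal_one_le_cases)
  case 1
  then show ?thesis by (simp add: lp_norm_def)
next
  case (2 r)
  have "\<bar>x $ i\<bar> \<le> lp_norm p x" for i
  proof -
    have "\<bar>x $ i\<bar> = (\<bar>x $ i\<bar> powr r) powr (1 / r)"
      using 2 by (simp add: powr_powr)
    also have "\<dots> \<le> (\<Sum>i\<in>UNIV. \<bar>x $ i\<bar> powr r) powr (1 / r)"
      using 2 by (intro powr_mono2 member_le_sum) auto
    finally show ?thesis using 2 by (simp add: lp_norm_def)
  qed
  then show ?thesis by (rule infnorm_cart_le)
qed

lemma lp_norm_le_infnorm:
  assumes "1 \<le> p"
  shows "lp_norm p (x :: real^'n::finite) \<le> real CARD('n) * infnorm x"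
  using assms
proof (cases rule: ereal_one_le_cases)
  case 1
  have "1 * infnorm x \<le> real CARD('n) * infnorm x"
    by (intro mult_right_mono) (auto simp: infnorm_pos_le)
  with 1 show ?thesis by (simp add: lp_norm_def)
next
  case (2 r)
  have "(\<Sum>i\<in>UNIV. \<bar>x $ i\<bar> powr r) \<le> (\<Sum>i\<in>(UNIV :: 'n set). infnorm x powr r)"
    using 2 by (intro sum_mono powr_mono2 component_le_infnorm_cart) auto
  then have "lp_norm p x \<le> (real CARD('n) * infnorm x powr r) powr (1 / r)"
    using 2 by (simp add: lp_norm_def powr_mono2 sum_nonneg)
  also have "\<dots> = real CARD('n) powr (1 / r) * infnorm x"
    using 2 by (simp add: powr_mult powr_powr infnorm_pos_le)
  also have "\<dots> \<le> real CARD('n) powr 1 * infnorm x"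
    using 2 by (intro mult_right_mono powr_mono) (auto simp: infnorm_pos_le Suc_le_eq)
  finally show ?thesis by simp
qed

lemma infnorm_unit_box_le:
  "x \<in> unit_box \<Longrightarrow> y \<in> unit_box \<Longrightarrow> infnorm (x - y :: real^'n::finite) \<le> 1"
proof (rule infnorm_cart_le)
  fix i assume "x \<in> unit_box" "y \<in> unit_box"
  then have "0 < x $ i" "x $ i < 1" "0 < y $ i" "y $ i < 1" by (auto simp: mem_box_cart)
  then show "\<bar>(x - y) $ i\<bar> \<le> 1" by simp
qed

lemma lp_norm_unit_box_le:
  assumes "1 \<le> p" "x \<in> unit_box" "y \<in> unit_box"
  shows "lp_norm p (x - y :: real^'n::finite) \<le> CARD('n)"
proof -
  have "lp_norm p (x - y) \<le> CARD('n) * infnorm (x - y)"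
    by (rule lp_norm_le_infnorm) fact
  also have "\<dots> \<le> real CARD('n) * 1"
    using assms by (intro mult_left_mono infnorm_unit_box_le) auto
  finally show ?thesis by simp
qed

lemma unit_box_half: "(\<chi> i. 1 / 2) \<in> (unit_box :: (real^'n::finite) set)"
  by (simp add: mem_box_cart)

section \<open>Laws on the cube: images and empirical measures\<close>

definition cube_prob :: "(real^'n::finite) measure \<Rightarrow> bool" where
  "cube_prob P \<longleftrightarrow> prob_space P \<and> sets P = sets cube_borel"

lemma cube_probD:
  assumes "cube_prob P"
  shows "prob_space P" "sets P = sets cube_borel" "space P = unit_box"
  using assms by (auto simp: cube_prob_def space_restrict_space dest: sets_eq_imp_space_eq)

lemma cube_prob_gen_law:
  assumes "cube_prob U" "G \<in> cube_borel \<rightarrow>\<^sub>M cube_borel"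
  shows "cube_prob (gen_law U G)"
proof -
  interpret U: prob_space U using assms by (simp add: cube_probD)
  have "G \<in> U \<rightarrow>\<^sub>M cube_borel"
    using assms(2) cube_probD(2)[OF assms(1)] by (simp cong: measurable_cong_sets)
  then show ?thesis by (simp add: cube_prob_def gen_law_def U.prob_space_distr)
qed

lemma integral_gen_law:
  fixes f :: "real^'d::finite \<Rightarrow> real"
  assumes "cube_prob U" "G \<in> cube_borel \<rightarrow>\<^sub>M cube_borel" "f \<in> borel_measurable cube_borel"
  shows "(\<integral>x. f x \<partial>gen_law U G) = (\<integral>z. f (G z) \<partial>U)"
proof -
  have "G \<in> U \<rightarrow>\<^sub>M cube_borel"
    using assms(2) cube_probD(2)[OF assms(1)] by (simp cong: measurable_cong_sets)
  then show ?thesis using assms(3) by (simp add: gen_law_def integral_distr)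
qed

lemma empirical_measurable:
  assumes "x ` {..<n} \<subseteq> unit_box"
  shows "x \<in> uniform_count_measure {..<n} \<rightarrow>\<^sub>M cube_borel"
  using assms
  by (auto 0 3 intro!: measurableI
      simp: image_subset_iff space_uniform_count_measure sets_uniform_count_measure space_restrict_space)

lemma cube_prob_empirical:
  assumes "1 \<le> n" "x ` {..<n} \<subseteq> unit_box"
  shows "cube_prob (empirical n x)"
proof -
  interpret prob_space "uniform_count_measure {..<n}"
    using assms by (intro prob_space_uniform_count_measure) (auto simp: lessThan_empty_iff)
  show ?thesis
    using prob_space_distr[OF empirical_measurable[OF assms(2)]]
    by (simp add: cube_prob_def empirical_def)
qed

lemma integral_empirical:
  fixes f :: "real^'d::finite \<Rightarrow> real"
  assumes "x ` {..<n} \<subseteq> unit_box" "f \<in> borel_measurable cube_borel"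
  shows "(\<integral>y. f y \<partial>empirical n x) = (\<Sum>i<n. f (x i)) / n"
  using empirical_measurable[OF assms(1)] assms(2)
  by (simp add: empirical_def integral_distr integral_uniform_count_measure)

lemma integrable_cube:
  fixes f :: "real^'d::finite \<Rightarrow> real"
  assumes "cube_prob P" "f \<in> borel_measurable cube_borel" "\<And>x. x \<in> unit_box \<Longrightarrow> \<bar>f x\<bar> \<le> c"
  shows "integrable P f"
proof -
  interpret P: prob_space P using assms by (simp add: cube_probD)
  have "f \<in> borel_measurable P"
    using assms(2) cube_probD(2)[OF assms(1)] by (simp cong: measurable_cong_sets)
  then show ?thesis
    using assms(3) by (intro P.integrable_const_bound[of _ c]) (auto simp: cube_probD(3)[OF assms(1)])
qed

section \<open>Regularity of Lipschitz test functions\<close>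

lemma lip_fun_infnorm:
  fixes W :: "real^'d::finite \<Rightarrow> real"
  assumes "1 \<le> p" "0 \<le> L" "W \<in> lip_fun p L B" "x \<in> unit_box" "y \<in> unit_box"
  shows "\<bar>W x - W y\<bar> \<le> L * real CARD('d) * infnorm (x - y)"
proof -
  have "\<bar>W x - W y\<bar> \<le> L * lp_norm p (x - y)"
    using assms by (simp add: lip_fun_def)
  also have "\<dots> \<le> L * (real CARD('d) * infnorm (x - y))"
    using assms by (intro mult_left_mono lp_norm_le_infnorm)
  finally show ?thesis by (simp add: mult.assoc)
qed

text \<open>The codomain is a general metric space so that real test functions and Lipschitz maps
  between cubes are both covered.\<close>

lemma measurable_cube_infnorm_lipschitz:
  fixes f :: "real^'n::finite \<Rightarrow> 'b::{metric_space}"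
  assumes lip: "\<And>x y. x \<in> unit_box \<Longrightarrow> y \<in> unit_box \<Longrightarrow> dist (f x) (f y) \<le> C * infnorm (x - y)"
  shows "f \<in> borel_measurable cube_borel"
proof (rule borel_measurable_continuous_on_restrict)
  have "(\<bar>C\<bar>)-lipschitz_on unit_box f"
  proof (rule lipschitz_onI)
    fix x y :: "real^'n" assume xy: "x \<in> unit_box" "y \<in> unit_box"
    have "dist (f x) (f y) \<le> C * infnorm (x - y)" by (rule lip) fact+
    also have "\<dots> \<le> \<bar>C\<bar> * dist x y"
      unfolding dist_norm by (intro mult_mono infnorm_le_norm) (auto simp: infnorm_pos_le)
    finally show "dist (f x) (f y) \<le> \<bar>C\<bar> * dist x y" .
  qed simp
  then show "continuous_on unit_box f" by (rule lipschitz_on_continuous_on)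
qed

lemma measurable_lip_fun:
  fixes W :: "real^'d::finite \<Rightarrow> real"
  assumes "1 \<le> p" "0 \<le> L" "W \<in> lip_fun p L B"
  shows "W \<in> borel_measurable cube_borel"
  by (rule measurable_cube_infnorm_lipschitz[where C="L * CARD('d)"])
    (use lip_fun_infnorm[OF assms] in \<open>simp add: dist_real_def\<close>)

text \<open>For \<open>B = \<infinity>\<close> the class carries no common bound, but each member is
  bounded: its value at the centre plus its oscillation over the cube.\<close>

lemma integrable_lip_fun:
  fixes W :: "real^'d::finite \<Rightarrow> real"
  assumes "1 \<le> p" "0 \<le> L" "W \<in> lip_fun p L B" "cube_prob P"
  shows "integrable P W"
proof (rule integrable_cube)
  let ?a = "(\<chi> i. 1 / 2) :: real^'d"
  fix x :: "real^'d" assume x: "x \<in> unit_box"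
  have "\<bar>W x - W ?a\<bar> \<le> L * CARD('d) * infnorm (x - ?a)"
    using assms x unit_box_half by (intro lip_fun_infnorm)
  also have "\<dots> \<le> L * CARD('d) * 1"
    using assms x unit_box_half by (intro mult_left_mono infnorm_unit_box_le) auto
  finally show "\<bar>W x\<bar> \<le> \<bar>W ?a\<bar> + L * CARD('d)" by simp
qed (use assms measurable_lip_fun in auto)

lemma integral_pair_add:
  fixes f g :: "'a \<Rightarrow> real"
  assumes "prob_space P" "prob_space Q" "integrable P f" "integrable Q g"
  shows "(\<integral>(x, y). f x + g y \<partial>(P \<Otimes>\<^sub>M Q)) = (\<integral>x. f x \<partial>P) + (\<integral>y. g y \<partial>Q)"
proof -
  interpret P: prob_space P by fact
  interpret Q: prob_space Q by fact
  interpret PQ: pair_prob_space P Q ..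
  have fst: "distr (P \<Otimes>\<^sub>M Q) P fst = P" by (rule Q.distr_pair_fst)
  \<comment> \<open>The second marginal is the first one after the factors are swapped.\<close>
  have snd: "distr (P \<Otimes>\<^sub>M Q) Q snd = Q"
  proof -
    have "distr (P \<Otimes>\<^sub>M Q) Q snd = distr (distr (P \<Otimes>\<^sub>M Q) (Q \<Otimes>\<^sub>M P) (\<lambda>(x, y). (y, x))) Q fst"
      by (subst distr_distr) (auto simp: comp_def case_prod_beta)
    also have "distr (P \<Otimes>\<^sub>M Q) (Q \<Otimes>\<^sub>M P) (\<lambda>(x, y). (y, x)) = Q \<Otimes>\<^sub>M P"
      by (rule pair_sigma_finite.distr_pair_swap[symmetric]) unfold_locales
    finally show ?thesis by (simp add: P.distr_pair_fst)
  qed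
  have f: "integrable (P \<Otimes>\<^sub>M Q) (\<lambda>z. f (fst z))"
    using assms(3) fst by (metis integrable_distr measurable_fst)
  have g: "integrable (P \<Otimes>\<^sub>M Q) (\<lambda>z. g (snd z))"
    using assms(4) snd by (metis integrable_distr measurable_snd)
  have "(\<integral>z. f (fst z) \<partial>(P \<Otimes>\<^sub>M Q)) = (\<integral>x. f x \<partial>P)"
    by (subst (2) fst[symmetric], subst integral_distr) (use assms(3) in auto)
  moreover have "(\<integral>z. g (snd z) \<partial>(P \<Otimes>\<^sub>M Q)) = (\<integral>x. g x \<partial>Q)"
    by (subst (2) snd[symmetric], subst integral_distr) (use assms(4) in auto)
  ultimately show ?thesis
    using Bochner_Integration.integral_add[OF f g] by (simp add: case_prod_beta')
qed

section \<open>Boundedness, symmetry and triangle inequality of \<open>wass1\<close>\<close>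

lemma wass1_alt:
  fixes P Q :: "(real^'d::finite) measure"
  assumes "1 \<le> p" "cube_prob P" "cube_prob Q"
  shows "wass1 p P Q = (SUP W\<in>lip_fun p 1 \<infinity>. (\<integral>x. W x \<partial>P) - (\<integral>x. W x \<partial>Q))"
  unfolding wass1_def
proof (rule SUP_cong)
  fix W :: "real^'d \<Rightarrow> real" assume W: "W \<in> lip_fun p 1 \<infinity>"
  have "integrable P W" "integrable Q (\<lambda>y. - W y)"
    using assms W integrable_lip_fun[OF assms(1) _ W] by auto
  from integral_pair_add[OF _ _ this] assms
  show "(\<integral>(x, y). W x - W y \<partial>(P \<Otimes>\<^sub>M Q)) = (\<integral>x. W x \<partial>P) - (\<integral>x. W x \<partial>Q)"
    by (simp add: cube_probD)
qed simp

lemma zero_in_lip_fun: "0 \<le> L \<Longrightarrow> 0 \<le> B \<Longrightarrow> (\<lambda>_. 0) \<in> lip_fun p L B"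
  by (simp add: lip_fun_def lp_norm_nonneg zero_ereal_def[symmetric])

lemma wass1_le:
  fixes P Q :: "(real^'d::finite) measure"
  assumes "1 \<le> p" "cube_prob P" "cube_prob Q"
    and "\<And>W. W \<in> lip_fun p 1 \<infinity> \<Longrightarrow> (\<integral>x. W x \<partial>P) - (\<integral>x. W x \<partial>Q) \<le> c"
  shows "wass1 p P Q \<le> c"
  unfolding wass1_alt[OF assms(1-3)] using assms(4) zero_in_lip_fun[of 1 \<infinity> p]
  by (intro cSUP_least) auto

text \<open>Every point is within 1/2 of the centre in \<open>infnorm\<close>, so comparison with
  the value there costs half the dimension for each law. This is also the boundedness that makes the
  real supremum in \<open>wass1\<close> an upper bound of its members.\<close>

lemma integral_diff_lip_fun_le_card:
  fixes P Q :: "(real^'d::finite) measure"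
  assumes "1 \<le> p" "cube_prob P" "cube_prob Q" "W \<in> lip_fun p 1 \<infinity>"
  shows "(\<integral>x. W x \<partial>P) - (\<integral>x. W x \<partial>Q) \<le> CARD('d)"
proof -
  interpret P: prob_space P using assms by (simp add: cube_probD)
  interpret Q: prob_space Q using assms by (simp add: cube_probD)
  let ?a = "(\<chi> i. 1 / 2) :: real^'d" and ?D = "real CARD('d)"
  have intP: "integrable P W" and intQ: "integrable Q W"
    using assms integrable_lip_fun[OF _ _ assms(4)] by auto
  have W: "\<bar>W x - W ?a\<bar> \<le> ?D / 2" if "x \<in> unit_box" for x
  proof -
    have "\<bar>W x - W ?a\<bar> \<le> 1 * ?D * infnorm (x - ?a)"
      using assms that unit_box_half by (intro lip_fun_infnorm) auto
    also have "infnorm (x - ?a) \<le> 1 / 2"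
    proof (rule infnorm_cart_le)
      fix i
      have "0 < x $ i" "x $ i < 1" using that by (auto simp: mem_box_cart)
      then show "\<bar>(x - ?a) $ i\<bar> \<le> 1 / 2"
        unfolding vector_minus_component vec_lambda_beta by linarith
    qed
    finally show ?thesis by simp
  qed
  have "(\<integral>x. W x - W ?a \<partial>P) \<le> (\<integral>x. ?D / 2 \<partial>P)"
    using intP abs_le_D1[OF W] by (intro integral_mono) (auto simp: cube_probD(3)[OF assms(2)])
  moreover have "(\<integral>x. - (?D / 2) \<partial>Q) \<le> (\<integral>x. W x - W ?a \<partial>Q)"
    using intQ abs_le_D2[OF W]
    by (intro integral_mono) (auto simp: cube_probD(3)[OF assms(3)] minus_le_iff[of _ "W _ - _"])
  ultimately show ?thesis
    using intP intQ by (simp add: P.prob_space Q.prob_space)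
qed

lemma wass1_le_card:
  fixes P Q :: "(real^'d::finite) measure"
  assumes "1 \<le> p" "cube_prob P" "cube_prob Q"
  shows "wass1 p P Q \<le> CARD('d)"
  using assms integral_diff_lip_fun_le_card by (intro wass1_le)

lemma wass1_ge:
  fixes P Q :: "(real^'d::finite) measure"
  assumes "1 \<le> p" "cube_prob P" "cube_prob Q" "W \<in> lip_fun p 1 \<infinity>"
  shows "(\<integral>x. W x \<partial>P) - (\<integral>x. W x \<partial>Q) \<le> wass1 p P Q"
  unfolding wass1_alt[OF assms(1-3)] using assms integral_diff_lip_fun_le_card
  by (intro cSUP_upper bdd_aboveI2) auto

lemma wass1_nonneg:
  fixes P Q :: "(real^'d::finite) measure"
  assumes "1 \<le> p" "cube_prob P" "cube_prob Q"
  shows "0 \<le> wass1 p P Q"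
  using wass1_ge[OF assms zero_in_lip_fun] by simp

lemma wass1_triangle:
  fixes P Q R :: "(real^'d::finite) measure"
  assumes "1 \<le> p" "cube_prob P" "cube_prob Q" "cube_prob R"
  shows "wass1 p P R \<le> wass1 p P Q + wass1 p Q R"
proof (rule wass1_le)
  fix W :: "real^'d \<Rightarrow> real" assume "W \<in> lip_fun p 1 \<infinity>"
  from wass1_ge[OF assms(1,2,3) this] wass1_ge[OF assms(1,3,4) this]
  show "(\<integral>x. W x \<partial>P) - (\<integral>x. W x \<partial>R) \<le> wass1 p P Q + wass1 p Q R" by simp
qed (use assms in auto)

lemma uminus_in_lip_fun: "W \<in> lip_fun p L B \<Longrightarrow> (\<lambda>x. - W x) \<in> lip_fun p L B"
  by (auto simp: lip_fun_def abs_minus_commute)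

lemma wass1_commute:
  fixes P Q :: "(real^'d::finite) measure"
  assumes "1 \<le> p" "cube_prob P" "cube_prob Q"
  shows "wass1 p P Q = wass1 p Q P"
proof -
  have *: "wass1 p P Q \<le> wass1 p Q P" if "cube_prob P" "cube_prob Q" for P Q :: "(real^'d) measure"
  proof (rule wass1_le)
    fix W :: "real^'d \<Rightarrow> real" assume W: "W \<in> lip_fun p 1 \<infinity>"
    from wass1_ge[OF assms(1) that(2,1) uminus_in_lip_fun[OF W]]
    show "(\<integral>x. W x \<partial>P) - (\<integral>x. W x \<partial>Q) \<le> wass1 p Q P" by simp
  qed (use assms that in auto)
  show ?thesis using *[of P Q] *[of Q P] assms by auto
qed

lemma lp_norm_le_sup_dist:
  fixes G H :: "real^'s::finite \<Rightarrow> real^'d::finite"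
  assumes "1 \<le> p" "G \<in> unit_box \<rightarrow> unit_box" "H \<in> unit_box \<rightarrow> unit_box" "z \<in> unit_box"
  shows "lp_norm p (G z - H z) \<le> sup_dist p G H"
  unfolding sup_dist_def using assms
  by (intro cSUP_upper bdd_aboveI2[where M="real CARD('d)"] lp_norm_unit_box_le)
    (auto simp del: mem_box_cart)

lemma measurable_cube_maps: "G \<in> cube_borel \<rightarrow>\<^sub>M cube_borel \<Longrightarrow> G \<in> unit_box \<rightarrow> unit_box"
  by (auto simp: space_restrict_space dest: measurable_space)

text \<open>Both laws are images of the same \<open>U\<close>, so \<open>(G z, H z)\<close> couples
  them and the test function is compared pointwise in \<open>z\<close>.\<close>

lemma wass1_gen_law_le_sup_dist:
  fixes G H :: "real^'s::finite \<Rightarrow> real^'d::finite"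
  assumes "1 \<le> p" "cube_prob U"
    and G: "G \<in> cube_borel \<rightarrow>\<^sub>M cube_borel" and H: "H \<in> cube_borel \<rightarrow>\<^sub>M cube_borel"
  shows "wass1 p (gen_law U G) (gen_law U H) \<le> sup_dist p G H"
proof (rule wass1_le)
  interpret U: prob_space U using assms by (simp add: cube_probD)
  fix W :: "real^'d \<Rightarrow> real" assume W: "W \<in> lip_fun p 1 \<infinity>"
  have mW: "W \<in> borel_measurable cube_borel" using measurable_lip_fun[OF assms(1) _ W] by simp
  have int: "integrable U (\<lambda>z. W (F z))" if F: "F \<in> cube_borel \<rightarrow>\<^sub>M cube_borel" for F :: "real^'s \<Rightarrow> real^'d"
  proof -
    have "F \<in> U \<rightarrow>\<^sub>M cube_borel"
      using F cube_probD(2)[OF assms(2)] by (simp cong: measurable_cong_sets)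
    moreover have "integrable (gen_law U F) W"
      using W assms F by (intro integrable_lip_fun cube_prob_gen_law) auto
    ultimately show ?thesis using mW by (simp add: gen_law_def integrable_distr_eq)
  qed
  have "(\<integral>z. W (G z) - W (H z) \<partial>U) \<le> (\<integral>z. sup_dist p G H \<partial>U)"
  proof (rule integral_mono)
    fix z assume "z \<in> space U"
    then have z: "z \<in> unit_box" by (simp add: cube_probD(3)[OF assms(2)])
    then have "W (G z) - W (H z) \<le> lp_norm p (G z - H z)"
      using W measurable_cube_maps[OF G] measurable_cube_maps[OF H]
      by (fastforce simp: lip_fun_def dest: abs_le_D1)
    also have "\<dots> \<le> sup_dist p G H"
      using assms z measurable_cube_maps[OF G] measurable_cube_maps[OF H]
      by (intro lp_norm_le_sup_dist) auto
    finally show "W (G z) - W (H z) \<le> sup_dist p G H" .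
  qed (use int[OF G] int[OF H] in auto)
  then show "(\<integral>x. W x \<partial>gen_law U G) - (\<integral>x. W x \<partial>gen_law U H) \<le> sup_dist p G H"
    using int[OF G] int[OF H] assms mW by (simp add: integral_gen_law U.prob_space)
qed (use assms in \<open>auto intro: cube_prob_gen_law\<close>)

section \<open>Comparison of the GAN value with the Wasserstein distance\<close>

text \<open>The logarithm of twice the logistic function, normalised to vanish at 0. The GAN
  integrand is \<open>lnlogistic (W x) + lnlogistic (- W y)\<close>.\<close>

definition lnlogistic :: "real \<Rightarrow> real" where
  "lnlogistic a = - ln ((1 + exp (- a)) / 2)"

lemma lnlogistic_deriv:
  "(lnlogistic has_real_derivative exp (- a) / (1 + exp (- a))) (at a)"
  unfolding lnlogistic_def[abs_def]
  by (auto intro!: derivative_eq_intros simp: divide_simps add_pos_pos add_nonneg_eq_0_iff)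

lemma lnlogistic_diff:
  assumes "a \<le> b"
  shows "0 \<le> lnlogistic b - lnlogistic a" "lnlogistic b - lnlogistic a \<le> b - a"
proof -
  have *: "0 < 1 + exp (- x)" for x :: real by (simp add: add_pos_pos)
  show "0 \<le> lnlogistic b - lnlogistic a"
    using DERIV_nonneg_imp_nondecreasing[OF assms, of lnlogistic] lnlogistic_deriv * 
    by (fastforce intro: divide_nonneg_pos)
  have "b - lnlogistic b \<ge> a - lnlogistic a"
  proof (rule DERIV_nonneg_imp_nondecreasing[OF assms])
    fix x
    have "((\<lambda>x. x - lnlogistic x) has_real_derivative 1 - exp (- x) / (1 + exp (- x))) (at x)"
      by (auto intro!: derivative_eq_intros lnlogistic_deriv)
    moreover have "0 \<le> 1 - exp (- x) / (1 + exp (- x))" using *[of x] by (simp add: divide_simps)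
    ultimately show "\<exists>y. ((\<lambda>x. x - lnlogistic x) has_real_derivative y) (at x) \<and> 0 \<le> y" by blast
  qed
  then show "lnlogistic b - lnlogistic a \<le> b - a" by simp
qed

lemma lnlogistic_lipschitz: "\<bar>lnlogistic a - lnlogistic b\<bar> \<le> \<bar>a - b\<bar>"
  using lnlogistic_diff[of a b] lnlogistic_diff[of b a] by linarith

lemma lnlogistic_le: "lnlogistic a \<le> ln 2"
proof -
  have "ln (1 / 2) \<le> ln ((1 + exp (- a)) / 2 :: real)"
    by (subst ln_le_cancel_iff) (auto simp: add_pos_pos)
  then show ?thesis by (simp add: lnlogistic_def ln_div)
qed

text \<open>The product of the two arguments of \<open>ln\<close> is the square of cosh (b / 2),
  which is at least 1. The bound turns a GAN objective into a difference of integrals of one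
  function.\<close>

lemma lnlogistic_minus_le: "lnlogistic (- b) \<le> - lnlogistic b"
proof -
  have "0 \<le> ln ((1 + exp (- b)) / 2 * ((1 + exp b) / 2))"
  proof (rule ln_ge_zero)
    have "exp (-b) * exp b = 1" by (simp add: exp_minus)
    moreover have "(exp (b / 2) - exp (- (b / 2)))\<^sup>2 = exp b + exp (- b) - 2"
      by (simp add: power2_diff flip: exp_add exp_double)
    then have "2 \<le> exp b + exp (- b)"
      using zero_le_power2[of "exp (b / 2) - exp (- (b / 2))"] by linarith
    ultimately show "1 \<le> (1 + exp (- b)) / 2 * ((1 + exp b) / 2)"
      by (simp add: algebra_simps)
  qed
  also have "\<dots> = ln ((1 + exp (- b)) / 2) + ln ((1 + exp b) / 2)"
    by (rule ln_mult_pos) (simp_all add: add_pos_pos)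
  finally show ?thesis by (simp add: lnlogistic_def)
qed

lemma lnlogistic_zero [simp]: "lnlogistic 0 = 0"
  by (simp add: lnlogistic_def)

text \<open>The right side is the quadratic that matches value 0 and slope 1/2 at the origin, with
  the least possible second derivative -1/4. The difference \<open>h\<close> has increasing
  derivative \<open>g\<close> with \<open>g 0 = 0\<close>, hence its minimum at 0.\<close>

lemma lnlogistic_ge: "a / 2 - a\<^sup>2 / 8 \<le> lnlogistic a"
proof -
  define g where "g x = exp (- x) / (1 + exp (- x)) - 1 / 2 + x / 4" for x :: real
  have pos: "0 < 1 + exp (- x)" for x :: real by (simp add: add_pos_pos)
  have dg: "(g has_real_derivative 1 / 4 - exp (- x) / (1 + exp (- x))\<^sup>2) (at x)" for x
    unfolding g_def[abs_def] using pos[of x]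
    by (auto intro!: derivative_eq_intros simp: field_simps power2_eq_square)
  have "0 \<le> 1 / 4 - exp (- x) / (1 + exp (- x))\<^sup>2" for x :: real
  proof -
    have "exp (- x) \<le> 1 / 4 * (1 + exp (- x))\<^sup>2"
      using zero_le_power2[of "1 - exp (- x)"] by (simp add: power2_diff power2_sum)
    then have "exp (- x) / (1 + exp (- x))\<^sup>2 \<le> 1 / 4"
      using pos[of x] by (subst pos_divide_le_eq) auto
    then show ?thesis by simp
  qed
  then have mono: "g x \<le> g y" if "x \<le> y" for x y
    using DERIV_nonneg_imp_nondecreasing[OF that, of g] dg by blast
  have g0: "g 0 = 0" by (simp add: g_def)
  define h where "h x = lnlogistic x - (x / 2 - x\<^sup>2 / 8)" for x
  have dh: "(h has_real_derivative g x) (at x)" for x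
    unfolding h_def[abs_def] g_def by (auto intro!: derivative_eq_intros lnlogistic_deriv)
  have "h 0 \<le> h a"
  proof (cases "0 \<le> a")
    case True
    show ?thesis
      by (rule DERIV_nonneg_imp_nondecreasing[OF True]) (use dh mono g0 in metis)
  next
    case False
    show ?thesis
      by (rule DERIV_nonpos_imp_nonincreasing[of a 0]) (use dh mono g0 False in \<open>auto, metis\<close>)
  qed
  then show ?thesis by (simp add: h_def)
qed

lemma lnlogistic_comp_lip_fun:
  assumes "W \<in> lip_fun p L B"
  shows "(\<lambda>x. lnlogistic (W x)) \<in> lip_fun p L \<infinity>"
  using assms unfolding lip_fun_def
  by (auto intro: order_trans[OF lnlogistic_lipschitz])

lemma scale_lip_fun:
  assumes "W \<in> lip_fun p L \<infinity>" "0 \<le> c"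
  shows "(\<lambda>x. c * W x) \<in> lip_fun p (c * L) \<infinity>"
  using assms unfolding lip_fun_def
  by (auto simp: abs_mult mult.assoc mult_left_mono simp flip: right_diff_distrib)

section \<open>Upper and lower comparison of \<open>gan_val\<close> with
  \<open>wass1\<close>\<close>

lemma gan_val_alt:
  fixes P Q :: "(real^'d::finite) measure"
  assumes "1 \<le> p" "cube_prob P" "cube_prob Q" "0 \<le> L"
  shows "gan_val (lip_fun p L B) P Q =
    (SUP W\<in>lip_fun p L B. (\<integral>x. lnlogistic (W x) \<partial>P) + (\<integral>x. lnlogistic (- W x) \<partial>Q))"
  unfolding gan_val_def
proof (rule SUP_cong)
  fix W :: "real^'d \<Rightarrow> real" assume W: "W \<in> lip_fun p L B"
  have "integrable P (\<lambda>x. lnlogistic (W x))" "integrable Q (\<lambda>x. lnlogistic (- W x))"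
    using assms lnlogistic_comp_lip_fun[OF W] lnlogistic_comp_lip_fun[OF uminus_in_lip_fun[OF W]]
    by (auto intro: integrable_lip_fun)
  from integral_pair_add[OF _ _ this] assms
  show "(\<integral>(x, y). - ln ((1 + exp (- W x)) / 2) - ln ((1 + exp (W y)) / 2) \<partial>(P \<Otimes>\<^sub>M Q))
      = (\<integral>x. lnlogistic (W x) \<partial>P) + (\<integral>x. lnlogistic (- W x) \<partial>Q)"
    by (simp add: cube_probD lnlogistic_def)
qed simp

text \<open>By \<open>lnlogistic_minus_le\<close> the objective of \<open>W\<close> is at most the
  integral difference of \<open>lnlogistic\<close> composed with \<open>W\<close>. That composition
  is \<open>L\<close>-Lipschitz, so dividing by \<open>L\<close> gives a test function for
  \<open>wass1\<close>.\<close>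

lemma gan_val_le_wass1:
  fixes P Q :: "(real^'d::finite) measure"
  assumes "1 \<le> p" "cube_prob P" "cube_prob Q" "0 < L" "0 \<le> B"
  shows "gan_val (lip_fun p L B) P Q \<le> L * wass1 p P Q"
  unfolding gan_val_alt[OF assms(1-3) less_imp_le[OF assms(4)]]
proof (rule cSUP_least)
  show "lip_fun p L B \<noteq> {}" using zero_in_lip_fun[of L B p] assms by auto
  fix W :: "real^'d \<Rightarrow> real" assume W: "W \<in> lip_fun p L B"
  let ?f = "\<lambda>x. lnlogistic (W x)"
  have f: "?f \<in> lip_fun p L \<infinity>" by (rule lnlogistic_comp_lip_fun[OF W])
  have f1: "(\<lambda>x. (1 / L) * ?f x) \<in> lip_fun p 1 \<infinity>"
    using scale_lip_fun[OF f, of "1 / L"] assms by simp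
  have "(\<integral>x. lnlogistic (- W x) \<partial>Q) \<le> (\<integral>x. - ?f x \<partial>Q)"
    using assms lnlogistic_minus_le integrable_lip_fun[OF assms(1) _ f assms(3)]
      integrable_lip_fun[OF assms(1) _ lnlogistic_comp_lip_fun[OF uminus_in_lip_fun[OF W]] assms(3)]
    by (intro integral_mono) auto
  then have "(\<integral>x. ?f x \<partial>P) + (\<integral>x. lnlogistic (- W x) \<partial>Q) \<le> (\<integral>x. ?f x \<partial>P) - (\<integral>x. ?f x \<partial>Q)"
    by simp
  also have "\<dots> = L * ((\<integral>x. (1 / L) * ?f x \<partial>P) - (\<integral>x. (1 / L) * ?f x \<partial>Q))"
    using assms by (simp only: integral_mult_right_zero) (simp add: field_simps)
  also have "\<dots> \<le> L * wass1 p P Q"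
    using assms f1 by (intro mult_left_mono wass1_ge) auto
  finally show "(\<integral>x. ?f x \<partial>P) + (\<integral>x. lnlogistic (- W x) \<partial>Q) \<le> L * wass1 p P Q" .
qed

lemma gan_val_ge:
  fixes P Q :: "(real^'d::finite) measure"
  assumes "1 \<le> p" "cube_prob P" "cube_prob Q" "0 \<le> L" "W \<in> lip_fun p L B"
  shows "(\<integral>x. lnlogistic (W x) \<partial>P) + (\<integral>x. lnlogistic (- W x) \<partial>Q) \<le> gan_val (lip_fun p L B) P Q"
  unfolding gan_val_alt[OF assms(1-4)]
proof (rule cSUP_upper[OF assms(5)])
  interpret P: prob_space P using assms by (simp add: cube_probD)
  interpret Q: prob_space Q using assms by (simp add: cube_probD)
  show "bdd_above ((\<lambda>W. (\<integral>x. lnlogistic (W x) \<partial>P) + (\<integral>x. lnlogistic (- W x) \<partial>Q)) ` lip_fun p L B)"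
  proof (rule bdd_aboveI2)
    fix W :: "real^'d \<Rightarrow> real" assume W: "W \<in> lip_fun p L B"
    have "(\<integral>x. lnlogistic (W x) \<partial>P) \<le> ln 2" "(\<integral>x. lnlogistic (- W x) \<partial>Q) \<le> ln 2"
      using assms lnlogistic_comp_lip_fun[OF W] lnlogistic_comp_lip_fun[OF uminus_in_lip_fun[OF W]]
      by (auto intro!: P.integral_le_const Q.integral_le_const integrable_lip_fun lnlogistic_le)
    then show "(\<integral>x. lnlogistic (W x) \<partial>P) + (\<integral>x. lnlogistic (- W x) \<partial>Q) \<le> ln 2 + ln 2" by simp
  qed
qed

text \<open>
  Let \<open>\<Delta>\<close> be the integral difference of an admissible function for \<open>wass1\<close>, and \<open>d\<close> the dimension.
  Centred and scaled by \<open>t \<le> 1 / d\<close>, that function is admissible for the GAN value and gives the lower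
  bound \<open>t \<Delta> / 2 - t\<^sup>2 d\<^sup>2 / 4\<close>, which is maximal at \<open>t = \<Delta> / d\<^sup>2\<close>.
\<close>

lemma wass1_le_sqrt_gan_val:
  fixes P Q :: "(real^'d::finite) measure"
  assumes p: "1 \<le> p" and P: "cube_prob P" and Q: "cube_prob Q" and "1 \<le> L" "1 \<le> B"
  shows "0 \<le> gan_val (lip_fun p L B) P Q" (is "0 \<le> ?V")
    and "wass1 p P Q \<le> 2 * real CARD('d) * sqrt (gan_val (lip_fun p L B) P Q)"
proof -
  interpret P: prob_space P using P by (simp add: cube_probD)
  interpret Q: prob_space Q using Q by (simp add: cube_probD)
  let ?D = "real CARD('d)"
  have B0: "0 \<le> B" using \<open>1 \<le> B\<close> by (rule order_trans[rotated]) simp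
  show V0: "0 \<le> ?V"
    using gan_val_ge[OF p P Q _ zero_in_lip_fun, of L B] assms B0 by simp
  have D1: "1 \<le> ?D" by (simp add: Suc_le_eq)
  show "wass1 p P Q \<le> 2 * ?D * sqrt ?V"
  proof (rule wass1_le[OF p P Q])
    fix W :: "real^'d \<Rightarrow> real" assume W: "W \<in> lip_fun p 1 \<infinity>"
    define \<Delta> where "\<Delta> = (\<integral>x. W x \<partial>P) - (\<integral>x. W x \<partial>Q)"
    have le: "\<Delta> \<le> ?D" unfolding \<Delta>_def by (rule integral_diff_lip_fun_le_card[OF p P Q W])
    have "\<Delta> \<le> 2 * ?D * sqrt ?V"
    proof (cases "0 \<le> \<Delta>")
      case False
      then show ?thesis
        using V0 by (meson linear mult_nonneg_nonneg of_nat_0_le_iff order_trans real_sqrt_ge_zero zero_le_numeral)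
    next
      case True
      let ?a = "(\<chi> i. 1 / 2) :: real^'d"
      define t where "t = \<Delta> / ?D\<^sup>2"
      define W' where "W' x = t * (W x - W ?a)" for x
      \<comment> \<open>The bound \<open>t \<le> 1 / ?D\<close> is exactly
        \<open>\<Delta> \<le> ?D\<close>. It keeps \<open>W'\<close> below 1 in absolute value,
        hence below every admissible \<open>B\<close>.\<close>
      have t: "0 \<le> t" "t \<le> 1 / ?D"
        using True le D1 by (auto simp: t_def power2_eq_square divide_simps)
      have t1: "t \<le> 1" using order_trans[OF t(2), of 1] D1 by simp
      have bd: "\<bar>W' x\<bar> \<le> t * ?D" if "x \<in> unit_box" for x
      proof -
        have "\<bar>W x - W ?a\<bar> \<le> lp_norm p (x - ?a)" using W that unit_box_half unfolding lip_fun_def by fastforce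
        also have "\<dots> \<le> ?D" using p that unit_box_half by (intro lp_norm_unit_box_le)
        finally show ?thesis using t by (simp add: W'_def abs_mult mult_left_mono)
      qed
      have "(\<lambda>x. t * W x) \<in> lip_fun p (t * 1) \<infinity>" by (rule scale_lip_fun[OF W t(1)])
      then have lip: "\<bar>W' x - W' y\<bar> \<le> t * lp_norm p (x - y)" if "x \<in> unit_box" "y \<in> unit_box" for x y
        using that by (auto simp: lip_fun_def W'_def algebra_simps)
      have W': "W' \<in> lip_fun p L B"
        unfolding lip_fun_def
      proof (intro CollectI conjI ballI)
        fix x :: "real^'d" assume x: "x \<in> unit_box"
        have "t * ?D \<le> 1" using t D1 by (simp add: divide_simps)
        with bd[OF x] have "ereal \<bar>W' x\<bar> \<le> 1" by simp
        then show "ereal \<bar>W' x\<bar> \<le> B" using \<open>1 \<le> B\<close> by (rule order_trans)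
      next
        fix x y :: "real^'d" assume xy: "x \<in> unit_box" "y \<in> unit_box"
        have "t * lp_norm p (x - y) \<le> L * lp_norm p (x - y)"
          using t1 \<open>1 \<le> L\<close> by (intro mult_right_mono lp_norm_nonneg) auto
        with lip[OF xy] show "\<bar>W' x - W' y\<bar> \<le> L * lp_norm p (x - y)" by linarith
      qed
      \<comment> \<open>The sign \<open>s\<close> is 1 for \<open>P\<close> and -1 for
        \<open>Q\<close>: the linear terms then combine to \<open>t * \<Delta> / 2\<close>, while
        the quadratic losses add up.\<close>
      have lower: "s * W' x / 2 - (t * ?D)\<^sup>2 / 8 \<le> lnlogistic (s * W' x)"
        if "x \<in> unit_box" "\<bar>s\<bar> = 1" for x s
      proof -
        have "(s * W' x)\<^sup>2 = \<bar>W' x\<bar>\<^sup>2" using that by (metis abs_mult mult_1 power2_abs)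
        also have "\<dots> \<le> (t * ?D)\<^sup>2" using bd[OF that(1)] by (intro power_mono) auto
        finally show ?thesis using lnlogistic_ge[of "s * W' x"] by simp
      qed
      have int: "integrable R W'" "integrable R (\<lambda>x. lnlogistic (W' x))" "integrable R (\<lambda>x. lnlogistic (- W' x))"
        if "cube_prob R" for R
        using that W' p \<open>1 \<le> L\<close> lnlogistic_comp_lip_fun[OF W'] lnlogistic_comp_lip_fun[OF uminus_in_lip_fun[OF W']]
        by (auto intro!: integrable_lip_fun[of p L])
      have intW: "integrable P W" "integrable Q W" using p P Q W integrable_lip_fun[OF p _ W] by auto
      have "(\<integral>x. W' x / 2 - (t * ?D)\<^sup>2 / 8 \<partial>P) \<le> (\<integral>x. lnlogistic (W' x) \<partial>P)"
        using int[OF P] lower[of _ 1] by (intro integral_mono) (auto simp: cube_probD(3)[OF P])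
      moreover have "(\<integral>x. - W' x / 2 - (t * ?D)\<^sup>2 / 8 \<partial>Q) \<le> (\<integral>x. lnlogistic (- W' x) \<partial>Q)"
        using int[OF Q] lower[of _ "- 1"] by (intro integral_mono) (auto simp: cube_probD(3)[OF Q])
      moreover have "(\<integral>x. W' x \<partial>P) - (\<integral>x. W' x \<partial>Q) = t * \<Delta>"
        using intW by (simp add: W'_def \<Delta>_def P.prob_space Q.prob_space algebra_simps)
      moreover have "(\<integral>x. lnlogistic (W' x) \<partial>P) + (\<integral>x. lnlogistic (- W' x) \<partial>Q) \<le> ?V"
        using p P Q \<open>1 \<le> L\<close> W' by (intro gan_val_ge) auto
      ultimately have "t * \<Delta> / 2 - (t * ?D)\<^sup>2 / 4 \<le> ?V"
        using int[OF P] int[OF Q] by (simp add: P.prob_space Q.prob_space)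
      moreover have "t * \<Delta> / 2 - (t * ?D)\<^sup>2 / 4 = \<Delta>\<^sup>2 / (4 * ?D\<^sup>2)"
        using D1 by (simp add: t_def power2_eq_square field_simps)
      ultimately have "(\<Delta> / (2 * ?D))\<^sup>2 \<le> ?V" by (simp add: power_divide power_mult_distrib)
      then have "\<Delta> / (2 * ?D) \<le> sqrt ?V" by (rule real_le_rsqrt)
      then show ?thesis using D1 by (simp add: field_simps)
    qed
    then show "(\<integral>x. W x \<partial>P) - (\<integral>x. W x \<partial>Q) \<le> 2 * ?D * sqrt ?V" by (simp add: \<Delta>_def)
  qed
qed

section \<open>Chaining along a nested sequence of finite partitions\<close>

lemma integral_finite_range:
  fixes F :: "'j \<Rightarrow> real"
  assumes "prob_space P" "finite J" and q: "q \<in> P \<rightarrow>\<^sub>M count_space J"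
  shows "integrable P (\<lambda>x. F (q x))"
    and "(\<integral>x. F (q x) \<partial>P) = (\<Sum>j\<in>J. F j * measure P (q -` {j} \<inter> space P))"
proof -
  interpret prob_space P by fact
  have A: "q -` {j} \<inter> space P \<in> sets P" if "j \<in> J" for j
    using q that by (auto intro: measurable_sets)
  have eq: "F (q x) = (\<Sum>j\<in>J. F j * indicator (q -` {j} \<inter> space P) x)" if "x \<in> space P" for x
  proof -
    have "q x \<in> J" using measurable_space[OF q that] by simp
    then have "F (q x) = (\<Sum>j\<in>J. if q x = j then F j else 0)" using assms(2) by simp
    also have "\<dots> = (\<Sum>j\<in>J. F j * indicator (q -` {j} \<inter> space P) x)"
      using that by (intro sum.cong) (auto simp: indicator_def)
    finally show ?thesis .
  qed
  have int: "integrable P (\<lambda>x. \<Sum>j\<in>J. F j * indicator (q -` {j} \<inter> space P) x)"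
    using A by (auto intro!: Bochner_Integration.integrable_sum integrable_mult_right
        simp: less_top[symmetric])
  show "integrable P (\<lambda>x. F (q x))"
    using int eq by (simp cong: Bochner_Integration.integrable_cong)
  have "(\<integral>x. F (q x) \<partial>P) = (\<integral>x. (\<Sum>j\<in>J. F j * indicator (q -` {j} \<inter> space P) x) \<partial>P)"
    using eq by (intro Bochner_Integration.integral_cong) auto
  also have "\<dots> = (\<Sum>j\<in>J. F j * measure P (q -` {j} \<inter> space P))"
    using A by (subst Bochner_Integration.integral_sum)
      (auto simp: less_top[symmetric] intro!: integrable_mult_right)
  finally show "(\<integral>x. F (q x) \<partial>P) = (\<Sum>j\<in>J. F j * measure P (q -` {j} \<inter> space P))" .
qed

text \<open>Telescoping of \<open>W\<close> along the labels \<open>q k x\<close>. The increment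
  from level \<open>k\<close> to \<open>Suc k\<close> is a function of the finer label alone, since
  \<open>par\<close> recovers the coarser one; so it is integrated by cell masses, and only their
  differences enter. At the root the approximation is constant and cancels between two laws of mass
  1. The error \<open>h\<close> at the finest level may vary with \<open>x\<close>.\<close>

lemma chaining:
  fixes F :: "nat \<Rightarrow> 'j \<Rightarrow> real"
  assumes P: "prob_space P" and Q: "prob_space Q" and sets: "sets Q = sets P"
    and J: "\<And>k. k \<le> K \<Longrightarrow> finite (J k)"
    and q: "\<And>k. k \<le> K \<Longrightarrow> q k \<in> P \<rightarrow>\<^sub>M count_space (J k)"
    and parent: "\<And>k x. k < K \<Longrightarrow> x \<in> space P \<Longrightarrow> q k x = par (q (Suc k) x)"
    and root: "\<And>x. x \<in> space P \<Longrightarrow> q 0 x = j0"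
    and b: "\<And>k j. k < K \<Longrightarrow> j \<in> J (Suc k) \<Longrightarrow> \<bar>F (Suc k) j - F k (par j)\<bar> \<le> b k"
    and W: "integrable P W" "integrable Q W" and h: "integrable P h" "integrable Q h"
    and Wh: "\<And>x. x \<in> space P \<Longrightarrow> \<bar>W x - F K (q K x)\<bar> \<le> h x"
  shows "(\<integral>x. W x \<partial>P) - (\<integral>x. W x \<partial>Q) \<le> (\<integral>x. h x \<partial>P) + (\<integral>x. h x \<partial>Q) +
    (\<Sum>k<K. b k * (\<Sum>j\<in>J (Suc k). \<bar>measure P (q (Suc k) -` {j} \<inter> space P) -
                               measure Q (q (Suc k) -` {j} \<inter> space P)\<bar>))"
proof -
  interpret P: prob_space P by fact
  interpret Q: prob_space Q by fact
  have sp: "space Q = space P" using sets by (rule sets_eq_imp_space_eq)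
  have qQ: "q k \<in> Q \<rightarrow>\<^sub>M count_space (J k)" if "k \<le> K" for k
    using q[OF that] sets by (simp cong: measurable_cong_sets)
  note fP = integral_finite_range[OF P J q] and fQ = integral_finite_range[OF Q J qQ, unfolded sp]
  define R where "R k = (\<Sum>j\<in>J (Suc k). \<bar>measure P (q (Suc k) -` {j} \<inter> space P) -
                               measure Q (q (Suc k) -` {j} \<inter> space P)\<bar>)" for k
  have step: "(\<integral>x. F k (q k x) \<partial>P) - (\<integral>x. F k (q k x) \<partial>Q) \<le> (\<Sum>i<k. b i * R i)" if "k \<le> K" for k
    using that
  proof (induction k)
    case 0
    have "(\<integral>x. F 0 (q 0 x) \<partial>P) = (\<integral>x. F 0 j0 \<partial>P)" "(\<integral>x. F 0 (q 0 x) \<partial>Q) = (\<integral>x. F 0 j0 \<partial>Q)"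
      by (rule Bochner_Integration.integral_cong; simp add: root sp)+
    then show ?case by (simp add: P.prob_space Q.prob_space)
  next
    case (Suc k)
    let ?g = "\<lambda>j. F (Suc k) j - F k (par j)"
    let ?A = "\<lambda>j. q (Suc k) -` {j} \<inter> space P"
    have k: "k \<le> K" "Suc k \<le> K" using Suc.prems by auto
    have dP: "(\<integral>x. F (Suc k) (q (Suc k) x) \<partial>P) - (\<integral>x. F k (q k x) \<partial>P) = (\<integral>x. ?g (q (Suc k) x) \<partial>P)"
    proof -
      have "(\<integral>x. ?g (q (Suc k) x) \<partial>P) = (\<integral>x. F (Suc k) (q (Suc k) x) - F k (q k x) \<partial>P)"
        using Suc.prems parent by (intro Bochner_Integration.integral_cong) auto
      also have "\<dots> = (\<integral>x. F (Suc k) (q (Suc k) x) \<partial>P) - (\<integral>x. F k (q k x) \<partial>P)"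
        using fP(1)[OF k(1) k(1)] fP(1)[OF k(2) k(2)] by (rule Bochner_Integration.integral_diff[rotated])
      finally show ?thesis by simp
    qed
    have dQ: "(\<integral>x. F (Suc k) (q (Suc k) x) \<partial>Q) - (\<integral>x. F k (q k x) \<partial>Q) = (\<integral>x. ?g (q (Suc k) x) \<partial>Q)"
    proof -
      have "(\<integral>x. ?g (q (Suc k) x) \<partial>Q) = (\<integral>x. F (Suc k) (q (Suc k) x) - F k (q k x) \<partial>Q)"
        using Suc.prems parent by (intro Bochner_Integration.integral_cong) (auto simp: sp)
      also have "\<dots> = (\<integral>x. F (Suc k) (q (Suc k) x) \<partial>Q) - (\<integral>x. F k (q k x) \<partial>Q)"
        using fQ(1)[OF k(1) k(1)] fQ(1)[OF k(2) k(2)] by (rule Bochner_Integration.integral_diff[rotated])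
      finally show ?thesis by simp
    qed
    have "(\<integral>x. ?g (q (Suc k) x) \<partial>P) - (\<integral>x. ?g (q (Suc k) x) \<partial>Q)
        = (\<Sum>j\<in>J (Suc k). ?g j * (measure P (?A j) - measure Q (?A j)))"
      using fP(2)[OF k(2) k(2), of ?g] fQ(2)[OF k(2) k(2), of ?g]
      by (simp add: sum_subtractf right_diff_distrib)
    also have "\<dots> \<le> (\<Sum>j\<in>J (Suc k). b k * \<bar>measure P (?A j) - measure Q (?A j)\<bar>)"
    proof (rule sum_mono)
      fix j assume j: "j \<in> J (Suc k)"
      have "?g j * (measure P (?A j) - measure Q (?A j)) \<le> \<bar>?g j\<bar> * \<bar>measure P (?A j) - measure Q (?A j)\<bar>"
        by (metis abs_ge_self abs_mult)
      also have "\<dots> \<le> b k * \<bar>measure P (?A j) - measure Q (?A j)\<bar>"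
        using b[OF _ j] k by (intro mult_right_mono) auto
      finally show "?g j * (measure P (?A j) - measure Q (?A j)) \<le> b k * \<bar>measure P (?A j) - measure Q (?A j)\<bar>" .
    qed
    also have "\<dots> = b k * R k" by (simp add: R_def sum_distrib_left)
    finally show ?case using Suc.IH k dP dQ by simp
  qed
  have F: "integrable P (\<lambda>x. F K (q K x))" "integrable Q (\<lambda>x. F K (q K x))"
    by (rule fP(1) fQ(1); simp)+
  have "(\<integral>x. W x - F K (q K x) \<partial>P) \<le> (\<integral>x. h x \<partial>P)"
    using W h F abs_le_D1[OF Wh] by (intro integral_mono) auto
  moreover have "(\<integral>x. F K (q K x) - W x \<partial>Q) \<le> (\<integral>x. h x \<partial>Q)"
    using W h F abs_le_D2[OF Wh] by (intro integral_mono) (auto simp: sp)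
  ultimately show ?thesis
    using step[of K] W F by (simp add: R_def)
qed

text \<open>A measurable choice of a nearest point. A new index replaces the current choice on the
  set where it does at least as well, and that set is measurable because the current minimum
  is.\<close>

lemma measurable_argmin_finite:
  fixes f :: "'j \<Rightarrow> 'a \<Rightarrow> real"
  assumes "finite J" "J \<noteq> {}" "\<And>j. j \<in> J \<Longrightarrow> f j \<in> borel_measurable M"
  shows "\<exists>q \<in> M \<rightarrow>\<^sub>M count_space J. \<forall>x\<in>space M. \<forall>j\<in>J. f (q x) x \<le> f j x"
  using assms
proof (induction J rule: finite_ne_induct)
  case (singleton j)
  show ?case by (rule bexI[of _ "\<lambda>_. j"]) simp_all
next
  case (insert j J)
  have "\<exists>q \<in> M \<rightarrow>\<^sub>M count_space J. \<forall>x\<in>space M. \<forall>j\<in>J. f (q x) x \<le> f j x"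
    by (rule insert.IH) (simp add: insert.prems)
  then obtain q
    where q: "q \<in> M \<rightarrow>\<^sub>M count_space J" "\<forall>x\<in>space M. \<forall>j\<in>J. f (q x) x \<le> f j x"
    by (elim bexE)
  have q': "q \<in> M \<rightarrow>\<^sub>M count_space (insert j J)"
    by (rule measurable_compose[OF q(1)]) (simp add: measurable_count_space_eq1)
  have "(\<lambda>x. f (q x) x) \<in> borel_measurable M"
  proof (rule measurable_compose_countable'[OF _ q(1)])
    show "f i \<in> borel_measurable M" if "i \<in> J" for i using that by (simp add: insert.prems)
    show "countable J" using insert.hyps by (simp add: countable_finite)
  qed
  moreover have "f j \<in> borel_measurable M" by (simp add: insert.prems)
  ultimately have le: "{x \<in> space M. f j x \<le> f (q x) x} \<in> sets M"
    by (rule borel_measurable_le[rotated])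
  let ?q = "\<lambda>x. if f j x \<le> f (q x) x then j else q x"
  have "?q \<in> M \<rightarrow>\<^sub>M count_space (insert j J)"
    by (rule measurable_If[OF _ q' le]) simp
  moreover have "\<forall>x\<in>space M. \<forall>i\<in>insert j J. f (?q x) x \<le> f i x"
  proof (intro ballI)
    fix x i assume "x \<in> space M" "i \<in> insert j J"
    then have "i = j \<or> f (q x) x \<le> f i x" using q(2) by (elim insertE) simp_all
    then show "f (?q x) x \<le> f i x" by (elim disjE) simp_all
  qed
  ultimately show ?case by (intro bexI[where x="?q"])
qed

section \<open>Empirical frequencies\<close>

lemma PiM_integral_component:
  fixes g :: "'a \<Rightarrow> real"
  assumes P: "prob_space P" and i: "i \<in> I" and g: "integrable P g"
  shows "integrable (\<Pi>\<^sub>M i\<in>I. P) (\<lambda>x. g (x i))"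
    and "(\<integral>x. g (x i) \<partial>(\<Pi>\<^sub>M i\<in>I. P)) = (\<integral>y. g y \<partial>P)"
proof -
  have d: "distr (\<Pi>\<^sub>M i\<in>I. P) P (\<lambda>x. x i) = P"
    using distr_PiM_component[of I "\<lambda>_. P" i] P i by simp
  have m: "(\<lambda>x. x i) \<in> (\<Pi>\<^sub>M i\<in>I. P) \<rightarrow>\<^sub>M P" using i by simp
  show "integrable (\<Pi>\<^sub>M i\<in>I. P) (\<lambda>x. g (x i))"
    using g d m by (metis integrable_distr)
  show "(\<integral>x. g (x i) \<partial>(\<Pi>\<^sub>M i\<in>I. P)) = (\<integral>y. g y \<partial>P)"
    by (subst (2) d[symmetric], subst integral_distr[OF m]) (use g in auto)
qed

text \<open>Independence of two coordinates, obtained from the product formula for integrals with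
  the factor 1 at all other coordinates.\<close>

lemma PiM_integral_mult:
  fixes g :: "'a \<Rightarrow> real"
  assumes P: "prob_space P" and I: "finite I" "i \<in> I" "j \<in> I" "i \<noteq> j" and g: "integrable P g"
  shows "integrable (\<Pi>\<^sub>M i\<in>I. P) (\<lambda>x. g (x i) * g (x j))"
    and "(\<integral>x. g (x i) * g (x j) \<partial>(\<Pi>\<^sub>M i\<in>I. P)) = (\<integral>y. g y \<partial>P)\<^sup>2"
proof -
  interpret P: prob_space P by fact
  interpret product_sigma_finite "\<lambda>_. P" ..
  let ?f = "\<lambda>k. if k \<in> {i, j} then g else (\<lambda>_. 1)"
  have sub: "prod (\<lambda>k. if k \<in> {i, j} then c k else 1) I = c i * c j" for c :: "'b \<Rightarrow> real"
  proof -
    have "prod (\<lambda>k. if k \<in> {i, j} then c k else 1) I = prod c (I \<inter> {i, j})"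
      using I(1) by (simp add: prod.inter_restrict)
    also have "I \<inter> {i, j} = {i, j}" using I by auto
    finally show ?thesis using I(4) by simp
  qed
  have eq: "(\<Prod>k\<in>I. ?f k (x k)) = g (x i) * g (x j)" for x :: "'b \<Rightarrow> 'a"
    using sub[of "\<lambda>k. g (x k)"] by (simp add: if_distrib[of "\<lambda>h. h _"] cong: if_cong)
  have int: "integrable P (?f k)" for k using g by simp
  show "integrable (\<Pi>\<^sub>M i\<in>I. P) (\<lambda>x. g (x i) * g (x j))"
    using product_integrable_prod[OF I(1), of ?f] int by (simp only: eq)
  have "(\<integral>x. (\<Prod>k\<in>I. ?f k (x k)) \<partial>(\<Pi>\<^sub>M i\<in>I. P)) = (\<Prod>k\<in>I. (\<integral>y. ?f k y \<partial>P))"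
    by (rule product_integral_prod[OF I(1)]) (rule int)
  also have "\<dots> = (\<Prod>k\<in>I. if k \<in> {i, j} then (\<integral>y. g y \<partial>P) else 1)"
    by (intro prod.cong) (auto simp: P.prob_space)
  finally show "(\<integral>x. g (x i) * g (x j) \<partial>(\<Pi>\<^sub>M i\<in>I. P)) = (\<integral>y. g y \<partial>P)\<^sup>2"
    by (simp only: eq sub power2_eq_square)
qed

text \<open>
  The free parameter \<open>a\<close> replaces Jensen's inequality: \<open>\<bar>t\<bar> \<le> a t\<^sup>2 / 2 + 1 / (2 a)\<close>. It is chosen only
  after summation over a partition.
\<close>

lemma expectation_empirical_deviation:
  assumes P: "prob_space P" and A: "A \<in> sets P" and n: "1 \<le> n" and a: "0 < a"
  shows "integrable (\<Pi>\<^sub>M i\<in>{..<n}. P) (\<lambda>x. \<bar>measure P A - (\<Sum>i<n. indicator A (x i)) / real n\<bar>)" (is ?int)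
    and "(\<integral>x. \<bar>measure P A - (\<Sum>i<n. indicator A (x i)) / real n\<bar> \<partial>(\<Pi>\<^sub>M i\<in>{..<n}. P))
      \<le> a * measure P A / (2 * real n) + 1 / (2 * a)" (is ?le)
proof -
  interpret P: prob_space P by fact
  interpret Pn: prob_space "\<Pi>\<^sub>M i\<in>{..<n}. P" using P by (intro prob_space_PiM)
  let ?M = "\<Pi>\<^sub>M i\<in>{..<n}. P" and ?p = "measure P A"
  define g where "g y = ?p - indicator A y" for y
  have ind: "integrable P (indicator A :: _ \<Rightarrow> real)" using A by (simp add: less_top[symmetric])
  have ig: "integrable P g" unfolding g_def[abs_def] using ind by auto
  \<comment> \<open>The indicator equals its square, so \<open>(g y)\<^sup>2\<close> is affine in
    it. The variance p (1 - p) is bounded by p, not by 1/4: the masses p sum to 1 over a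
    partition.\<close>
  have g2: "(g y)\<^sup>2 = ?p\<^sup>2 + (1 - 2 * ?p) * indicator A y" for y
    by (simp add: g_def indicator_def power2_eq_square algebra_simps)
  have ig2: "integrable P (\<lambda>y. (g y)\<^sup>2)" unfolding g2 using ind by auto
  have Eg: "(\<integral>y. g y \<partial>P) = 0" unfolding g_def using ind A by (simp add: P.prob_space)
  have Eg2: "(\<integral>y. (g y)\<^sup>2 \<partial>P) \<le> ?p"
  proof -
    have "(\<integral>y. (g y)\<^sup>2 \<partial>P) = ?p\<^sup>2 + (1 - 2 * ?p) * ?p"
      unfolding g2 using ind A by (simp add: P.prob_space)
    also have "\<dots> \<le> ?p" by (simp add: power2_eq_square algebra_simps)
    finally show ?thesis .
  qed
  define f where "f x = ?p - (\<Sum>i<n. indicator A (x i)) / real n" for x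
  have f_eq: "f x = (\<Sum>i<n. g (x i)) / n" for x
    using n by (simp add: f_def g_def sum_subtractf field_simps)
  have f2: "(f x)\<^sup>2 = (\<Sum>i<n. \<Sum>j<n. g (x i) * g (x j)) / (real n)\<^sup>2" for x
    by (simp add: f_eq power_divide sum_product power2_eq_square)
  \<comment> \<open>Off-diagonal terms vanish as \<open>g\<close> is centred. The \<open>n\<close>
    diagonal terms, divided by the square of \<open>n\<close>, leave the factor 1/n.\<close>
  have gg: "integrable ?M (\<lambda>x. g (x i) * g (x j))"
     "(\<integral>x. g (x i) * g (x j) \<partial>?M) = (if i = j then (\<integral>y. (g y)\<^sup>2 \<partial>P) else 0)"
     if "i < n" "j < n" for i j
    using that PiM_integral_mult[OF P, of "{..<n}" i j g] PiM_integral_component[OF P _ ig2, of i "{..<n}"] ig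
    by (cases "i = j"; simp add: Eg power2_eq_square)+
  have if2: "integrable ?M (\<lambda>x. (f x)\<^sup>2)" unfolding f2
    by (intro integrable_divide_zero Bochner_Integration.integrable_sum impI gg(1)) auto
  have "(\<integral>x. (\<Sum>i<n. \<Sum>j<n. g (x i) * g (x j)) \<partial>?M) = (\<Sum>i<n. \<integral>x. (\<Sum>j<n. g (x i) * g (x j)) \<partial>?M)"
    by (intro Bochner_Integration.integral_sum Bochner_Integration.integrable_sum gg(1)) auto
  also have "\<dots> = (\<Sum>i<n. \<Sum>j<n. \<integral>x. g (x i) * g (x j) \<partial>?M)"
    by (intro sum.cong refl Bochner_Integration.integral_sum gg(1)) auto
  also have "\<dots> = (\<Sum>i<n. \<Sum>j<n. if i = j then (\<integral>y. (g y)\<^sup>2 \<partial>P) else 0)"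
    using gg(2) by (intro sum.cong refl) auto
  finally have "(\<integral>x. (f x)\<^sup>2 \<partial>?M) = (\<Sum>i<n. \<Sum>j<n. if i = j then (\<integral>y. (g y)\<^sup>2 \<partial>P) else 0) / (real n)\<^sup>2"
    unfolding f2 by simp
  also have "\<dots> = (\<integral>y. (g y)\<^sup>2 \<partial>P) / n" using n by (simp add: power2_eq_square)
  also have "\<dots> \<le> ?p / n" using Eg2 by (intro divide_right_mono) auto
  finally have Ef2: "(\<integral>x. (f x)\<^sup>2 \<partial>?M) \<le> ?p / n" .
  have iF: "integrable ?M f" unfolding f_eq
    by (intro integrable_divide_zero Bochner_Integration.integrable_sum impI PiM_integral_component(1)[OF P _ ig])
  then show ?int unfolding f_def by (rule integrable_abs)
  have "(\<integral>x. \<bar>f x\<bar> \<partial>?M) \<le> (\<integral>x. a / 2 * (f x)\<^sup>2 + 1 / (2 * a) \<partial>?M)"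
  proof (rule integral_mono)
    fix x
    have "0 \<le> (a * \<bar>f x\<bar> - 1)\<^sup>2" by simp
    then show "\<bar>f x\<bar> \<le> a / 2 * (f x)\<^sup>2 + 1 / (2 * a)"
    proof -
      have "2 * a * \<bar>f x\<bar> \<le> a\<^sup>2 * (f x)\<^sup>2 + 1"
        using \<open>0 \<le> (a * \<bar>f x\<bar> - 1)\<^sup>2\<close> by (simp add: power2_diff power_mult_distrib)
      then have "2 * a * \<bar>f x\<bar> / (2 * a) \<le> (a\<^sup>2 * (f x)\<^sup>2 + 1) / (2 * a)"
        using a by (intro divide_right_mono) auto
      with a show ?thesis by (simp add: add_divide_distrib power2_eq_square)
    qed
  qed (use iF if2 in auto)
  also have "\<dots> = a / 2 * (\<integral>x. (f x)\<^sup>2 \<partial>?M) + 1 / (2 * a)"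
    using if2 by (simp add: Pn.prob_space)
  also have "\<dots> \<le> a / 2 * (?p / n) + 1 / (2 * a)"
    using a Ef2 by (intro add_right_mono mult_left_mono) auto
  finally show ?le by (simp add: f_def)
qed

text \<open>Since the masses sum to 1, the summed bound is a / (2 n) + card J / (2 a), whatever the
  law. The choice \<open>a = sqrt (n * card J)\<close> makes both terms equal.\<close>

lemma expectation_empirical_partition:
  assumes P: "prob_space P" and J: "finite J" "J \<noteq> {}" and q: "q \<in> P \<rightarrow>\<^sub>M count_space J" and n: "1 \<le> n"
  shows "(\<Sum>j\<in>J. \<integral>x. \<bar>measure P (q -` {j} \<inter> space P) - (\<Sum>i<n. indicator (q -` {j} \<inter> space P) (x i)) / real n\<bar> \<partial>(\<Pi>\<^sub>M i\<in>{..<n}. P))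
      \<le> sqrt (card J / n)"
proof -
  interpret P: prob_space P by fact
  let ?p = "\<lambda>j. measure P (q -` {j} \<inter> space P)"
  define a where "a = sqrt (real n * card J)"
  have nc: "0 < real n" "0 < real (card J)" using n J by (auto simp: card_gt_0_iff)
  then have a: "0 < a" by (simp add: a_def)
  define s t where "s = sqrt n" and "t = sqrt (card J)"
  have st: "a = s * t" "real n = s * s" "real (card J) = t * t" "0 < s" "0 < t"
    using nc by (auto simp: a_def s_def t_def real_sqrt_mult)
  have A: "q -` {j} \<inter> space P \<in> sets P" if "j \<in> J" for j
    using q that by (auto intro: measurable_sets)
  have sum1: "(\<Sum>j\<in>J. ?p j) = 1"
    using integral_finite_range(2)[OF P J(1) q, of "\<lambda>_. 1"] by (simp add: P.prob_space)
  have "(\<Sum>j\<in>J. \<integral>x. \<bar>?p j - (\<Sum>i<n. indicator (q -` {j} \<inter> space P) (x i)) / real n\<bar> \<partial>(\<Pi>\<^sub>M i\<in>{..<n}. P))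
      \<le> (\<Sum>j\<in>J. a * ?p j / (2 * real n) + 1 / (2 * a))"
    using expectation_empirical_deviation(2)[OF P A n a] by (intro sum_mono) auto
  also have "\<dots> = a / (2 * real n) * (\<Sum>j\<in>J. ?p j) + card J / (2 * a)"
    by (simp add: sum.distrib sum_distrib_left sum_divide_distrib)
  also have "\<dots> = a / (2 * real n) + card J / (2 * a)" by (simp add: sum1)
  also have "\<dots> = t / s" using st(4,5) by (simp add: st(1-3))
  finally show ?thesis by (simp add: s_def t_def real_sqrt_divide)
qed

section \<open>Dyadic cells of the latent cube\<close>

definition cells :: "nat \<Rightarrow> ('s::finite \<Rightarrow> nat) set" where
  "cells k = {j. \<forall>i. j i < 2 ^ k}"

text \<open>Centres rather than corners: the corner with index 0 lies outside the open cube, where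
  the maps are not controlled.\<close>

definition cell_center :: "nat \<Rightarrow> ('s::finite \<Rightarrow> nat) \<Rightarrow> real^'s" where
  "cell_center k j = (\<chi> i. (real (j i) + 1 / 2) / 2 ^ k)"

lemma cells_PiE: "cells k = (\<Pi>\<^sub>E i\<in>(UNIV :: 's::finite set). {..<2 ^ k :: nat})"
  by (auto simp: cells_def PiE_def extensional_def)

lemma finite_cells: "finite (cells k)"
  unfolding cells_PiE by (intro finite_PiE) auto

lemma card_cells: "card (cells k :: ('s::finite \<Rightarrow> nat) set) = 2 ^ (k * CARD('s))"
  unfolding cells_PiE by (simp add: card_PiE power_mult)

lemma cells_nonempty: "cells k \<noteq> {}"
  by (auto simp: cells_def intro!: exI[of _ "\<lambda>_. 0"])

lemma cell_center_in_box:
  assumes "j \<in> cells k"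
  shows "cell_center k j \<in> unit_box"
proof -
  have "real (j i) + 1 / 2 < 2 ^ k" for i
  proof -
    have "Suc (j i) \<le> 2 ^ k" using assms by (simp add: cells_def Suc_le_eq)
    then have "real (Suc (j i)) \<le> 2 ^ k" by (metis of_nat_le_iff of_nat_numeral of_nat_power)
    then show ?thesis by simp
  qed
  then show ?thesis by (simp add: mem_box_cart cell_center_def pos_divide_less_eq add_nonneg_pos)
qed

text \<open>With r the remainder of \<open>j i\<close> modulo 2, the offset is (r - 1/2) /
  \<open>2 ^ Suc k\<close>, half the side of the child cell. It is rounded up to the full side,
  which affects constants only.\<close>

lemma cell_center_parent:
  "infnorm (cell_center (Suc k) j - cell_center k (\<lambda>i. j i div 2)) \<le> 1 / 2 ^ Suc k"
proof (rule infnorm_cart_le)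
  fix i
  have "(cell_center (Suc k) j - cell_center k (\<lambda>i. j i div 2)) $ i
      = (real (j i) + 1 / 2 - (2 * real (j i div 2) + 1)) / 2 ^ Suc k"
    by (simp add: cell_center_def field_simps)
  also have "real (j i) = 2 * real (j i div 2) + real (j i mod 2)"
    by (metis div_mult_mod_eq mult.commute of_nat_add of_nat_mult of_nat_numeral)
  also have "2 * real (j i div 2) + real (j i mod 2) + 1 / 2 - (2 * real (j i div 2) + 1) = real (j i mod 2) - 1 / 2"
    by simp
  finally have eq: "(cell_center (Suc k) j - cell_center k (\<lambda>i. j i div 2)) $ i
      = (real (j i mod 2) - 1 / 2) / 2 ^ Suc k" .
  have "j i mod 2 = 0 \<or> j i mod 2 = 1" by presburger
  then have "\<bar>real (j i mod 2) - 1 / 2\<bar> \<le> 1" by (elim disjE) simp_all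
  then show "\<bar>(cell_center (Suc k) j - cell_center k (\<lambda>i. j i div 2)) $ i\<bar> \<le> 1 / 2 ^ Suc k"
    unfolding eq abs_divide power_abs abs_numeral by (rule divide_right_mono) simp
qed

lemma ex_cell_near:
  assumes "z \<in> (unit_box :: (real^'s::finite) set)"
  shows "\<exists>j\<in>cells k. infnorm (z - cell_center k j) \<le> 1 / 2 ^ k"
proof
  let ?j = "\<lambda>i. nat \<lfloor>2 ^ k * z $ i\<rfloor>"
  have z: "0 < z $ i" "z $ i < 1" for i using assms by (auto simp: mem_box_cart)
  have fl: "real (?j i) \<le> 2 ^ k * z $ i" "2 ^ k * z $ i < real (?j i) + 1" for i
    using z[of i] by (simp_all add: of_nat_nat floor_less_iff)
  have "real (?j i) < 2 ^ k" for i
  proof -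
    have "2 ^ k * z $ i < 2 ^ k * 1" using z(2)[of i] by (rule mult_strict_left_mono) simp
    with fl(1)[of i] show ?thesis by linarith
  qed
  then have "?j i < 2 ^ k" for i by (metis of_nat_less_iff of_nat_numeral of_nat_power)
  then show "?j \<in> cells k" by (simp add: cells_def)
  show "infnorm (z - cell_center k ?j) \<le> 1 / 2 ^ k"
  proof (rule infnorm_cart_le)
    fix i
    have "(z - cell_center k ?j) $ i = (2 ^ k * z $ i - (real (?j i) + 1 / 2)) / 2 ^ k"
      by (simp add: cell_center_def field_simps)
    moreover have "\<bar>2 ^ k * z $ i - (real (?j i) + 1 / 2)\<bar> \<le> 1"
      using fl[of i] by linarith
    ultimately show "\<bar>(z - cell_center k ?j) $ i\<bar> \<le> 1 / 2 ^ k"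
      by (simp add: divide_right_mono)
  qed
qed

section \<open>Empirical measures of laws close to a Lipschitz image\<close>

lemma lip_maps_range: "G \<in> lip_maps p M \<Longrightarrow> z \<in> unit_box \<Longrightarrow> G z \<in> unit_box"
  by (auto simp: lip_maps_def)

lemma lip_maps_infnorm:
  fixes G :: "real^'s::finite \<Rightarrow> real^'d::finite"
  assumes "1 \<le> p" "0 \<le> M" "G \<in> lip_maps p M" "x \<in> unit_box" "y \<in> unit_box"
  shows "lp_norm p (G x - G y) \<le> M * real CARD('s) * infnorm (x - y)"
proof -
  have "lp_norm p (G x - G y) \<le> M * lp_norm p (x - y)"
    using assms by (simp add: lip_maps_def)
  also have "\<dots> \<le> M * (real CARD('s) * infnorm (x - y))"
    using assms by (intro mult_left_mono lp_norm_le_infnorm)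
  finally show ?thesis by (simp add: mult.assoc)
qed

lemma lip_maps_measurable:
  fixes G :: "real^'s::finite \<Rightarrow> real^'d::finite"
  assumes "1 \<le> p" "0 \<le> M" "G \<in> lip_maps p M"
  shows "G \<in> cube_borel \<rightarrow>\<^sub>M cube_borel"
proof (rule measurable_restrict_space2)
  show "G \<in> space cube_borel \<rightarrow> unit_box"
    using lip_maps_range[OF assms(3)] by (auto simp: space_restrict_space)
  show "G \<in> borel_measurable cube_borel"
  proof (rule measurable_cube_infnorm_lipschitz)
    fix x y :: "real^'s" assume xy: "x \<in> unit_box" "y \<in> unit_box"
    \<comment> \<open>\<open>dist\<close> is Euclidean, so the Lipschitz bound is transported
      through \<open>infnorm\<close>, at the price of the square root of the dimension.\<close>
    have "dist (G x) (G y) \<le> sqrt DIM(real^'d) * infnorm (G x - G y)"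
      unfolding dist_norm by (rule norm_le_infnorm)
    also have "\<dots> \<le> sqrt DIM(real^'d) * lp_norm p (G x - G y)"
      using assms by (intro mult_left_mono infnorm_le_lp_norm) auto
    also have "\<dots> \<le> sqrt DIM(real^'d) * (M * real CARD('s) * infnorm (x - y))"
      using assms xy by (intro mult_left_mono lip_maps_infnorm) auto
    finally show "dist (G x) (G y) \<le> (sqrt DIM(real^'d) * (M * real CARD('s))) * infnorm (x - y)"
      by (simp add: mult.assoc)
  qed
qed

text \<open>
  The law \<open>P\<close> is projected onto the images of the cell centres under \<open>Gs\<close> (nearest point at the
  finest level, ancestors of that cell above). The projection error is the integral of a distance
  function, which is itself an admissible test function in \<open>wass1\<close>; no coupling of \<open>P\<close> with the law
  of \<open>Gs\<close> is needed, and the number of cells depends on the latent dimension only.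
\<close>

lemma wass1_empirical_bound:
  fixes P :: "(real^'d::finite) measure" and U :: "(real^'s::finite) measure"
  assumes p: "1 \<le> p" and M: "0 \<le> M" and P: "cube_prob P" and U: "cube_prob U"
    and Gs: "Gs \<in> lip_maps p M" and n: "1 \<le> n"
  shows "\<exists>T. integrable (\<Pi>\<^sub>M i\<in>{..<n}. P) T \<and>
    (\<forall>x\<in>space (\<Pi>\<^sub>M i\<in>{..<n}. P). wass1 p P (empirical n x) \<le> T x) \<and>
    (\<integral>x. T x \<partial>(\<Pi>\<^sub>M i\<in>{..<n}. P)) \<le>
      2 * real CARD('d) * (wass1 p P (gen_law U Gs) + M * real CARD('s) / 2 ^ K) +
      (\<Sum>k<K. M * real CARD('s) / 2 ^ Suc k * sqrt (2 ^ (Suc k * CARD('s)) / real n))"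
proof -
  interpret P: prob_space P using P by (simp add: cube_probD)
  interpret U: prob_space U using U by (simp add: cube_probD)
  let ?PM = "\<Pi>\<^sub>M i\<in>{..<n}. P" and ?D = "real CARD('d)" and ?s = "real CARD('s)"
  have PS: "prob_space P" "sets P = sets cube_borel" "space P = unit_box" by (rule cube_probD[OF P])+
  define S where "S k j = Gs (cell_center k j)" for k j
  have S_box: "S k j \<in> unit_box" if "j \<in> cells k" for k j
    unfolding S_def by (intro lip_maps_range[OF Gs] cell_center_in_box that)
  \<comment> \<open>Distances to the finite net are taken in \<open>infnorm\<close>: continuous,
    hence measurable, and 1-Lipschitz for \<open>lp_norm p\<close> as well.\<close>
  define f where "f j x = infnorm (x - S K j)" for j x
  have f_lip: "f j x \<le> f j y + lp_norm p (x - y)" for j x y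
    using infnorm_triangle[of "x - y" "y - S K j"] infnorm_le_lp_norm[OF p, of "x - y"]
    by (simp add: f_def)
  have f_meas: "f j \<in> borel_measurable cube_borel" for j
    unfolding f_def by (intro borel_measurable_continuous_on_restrict continuous_intros)
  have "\<exists>q \<in> cube_borel \<rightarrow>\<^sub>M count_space (cells K). \<forall>x\<in>space cube_borel. \<forall>j\<in>cells K. f (q x) x \<le> f j x"
    by (rule measurable_argmin_finite[OF finite_cells cells_nonempty f_meas])
  then obtain q where q: "q \<in> cube_borel \<rightarrow>\<^sub>M count_space (cells K)"
    and q_min': "\<forall>x\<in>space cube_borel. \<forall>j\<in>cells K. f (q x) x \<le> f j x"
    by (elim bexE)
  have q_min: "f (q x) x \<le> f j x" if "x \<in> unit_box" "j \<in> cells K" for x j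
    using q_min' that by (simp add: space_restrict_space)
  have q_cells: "q x \<in> cells K" if "x \<in> unit_box" for x
    using measurable_space[OF q, of x] that by (simp add: space_restrict_space)
  define m where "m x = f (q x) x" for x
  \<comment> \<open>The cell chosen at \<open>y\<close> is a competitor at \<open>x\<close>, which
    gives one inequality; the other follows by symmetry of the norm.\<close>
  have m_lip: "m \<in> lip_fun p 1 \<infinity>"
  proof -
    have *: "m x - m y \<le> lp_norm p (x - y)" if "x \<in> unit_box" "y \<in> unit_box" for x y
      using q_min[OF that(1) q_cells[OF that(2)]] f_lip[of "q y" x y] by (simp add: m_def)
    have sym: "lp_norm p (y - x) = lp_norm p (x - y)" for x y :: "real^'d"
      by (simp add: lp_norm_def infnorm_sub abs_minus_commute)
    show ?thesis
      unfolding lip_fun_def using *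
      by (auto simp: abs_le_iff simp del: mem_box_cart) (metis sym)
  qed
  have m_meas: "m \<in> borel_measurable cube_borel" by (rule measurable_lip_fun[OF p _ m_lip]) simp
  have m_int: "integrable R m" if "cube_prob R" for R
    by (rule integrable_lip_fun[OF p _ m_lip that]) simp
  \<comment> \<open>The factor converts the \<open>infnorm\<close> distance to the net into a bound
    for \<open>lp_norm p\<close>, as the finest level of the chain demands.\<close>
  define h where "h x = ?D * m x" for x
  have h_meas: "h \<in> borel_measurable cube_borel" unfolding h_def[abs_def] using m_meas by simp
  have h_int: "integrable R h" if "cube_prob R" for R
    unfolding h_def[abs_def] using m_int[OF that] by simp
  have Gs_meas: "Gs \<in> cube_borel \<rightarrow>\<^sub>M cube_borel" by (rule lip_maps_measurable[OF p M Gs])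
  have law: "cube_prob (gen_law U Gs)" by (rule cube_prob_gen_law[OF U Gs_meas])
  have m_Gs: "m (Gs z) \<le> M * ?s / 2 ^ K" if z: "z \<in> unit_box" for z
  proof -
    obtain j where j: "j \<in> cells K" "infnorm (z - cell_center K j) \<le> 1 / 2 ^ K"
      using ex_cell_near[OF z] by blast
    have "m (Gs z) \<le> f j (Gs z)"
      unfolding m_def by (rule q_min[OF lip_maps_range[OF Gs z] j(1)])
    also have "\<dots> \<le> lp_norm p (Gs z - Gs (cell_center K j))"
      unfolding f_def S_def by (rule infnorm_le_lp_norm[OF p])
    also have "\<dots> \<le> M * ?s * infnorm (z - cell_center K j)"
      by (rule lip_maps_infnorm[OF p M Gs z cell_center_in_box[OF j(1)]])
    also have "\<dots> \<le> M * ?s * (1 / 2 ^ K)" using M j(2) by (intro mult_left_mono) auto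
    finally show ?thesis by simp
  qed
  have h_E: "(\<integral>x. h x \<partial>P) \<le> ?D * (wass1 p P (gen_law U Gs) + M * ?s / 2 ^ K)"
  proof -
    have "(\<integral>x. m x \<partial>gen_law U Gs) = (\<integral>z. m (Gs z) \<partial>U)"
      by (rule integral_gen_law[OF U Gs_meas m_meas])
    also have "\<dots> \<le> M * ?s / 2 ^ K"
    proof (rule U.integral_le_const)
      have "Gs \<in> U \<rightarrow>\<^sub>M cube_borel"
        using Gs_meas cube_probD(2)[OF U] by (simp cong: measurable_cong_sets)
      then show "integrable U (\<lambda>z. m (Gs z))"
        using m_int[OF law] m_meas by (simp add: gen_law_def integrable_distr_eq)
      show "AE z in U. m (Gs z) \<le> M * ?s / 2 ^ K"
        using m_Gs by (intro AE_I2) (simp add: cube_probD(3)[OF U])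
    qed
    finally have "(\<integral>x. m x \<partial>P) \<le> wass1 p P (gen_law U Gs) + M * ?s / 2 ^ K"
      using wass1_ge[OF p P law m_lip] by linarith
    then have "?D * (\<integral>x. m x \<partial>P) \<le> ?D * (wass1 p P (gen_law U Gs) + M * ?s / 2 ^ K)"
      by (rule mult_left_mono) simp
    then show ?thesis by (simp add: h_def)
  qed
  \<comment> \<open>The ancestor at level \<open>k\<close> of the chosen cell: \<open>K - k\<close>
    halvings of its index. Below level \<open>K\<close> its image need not be nearest to
    \<open>x\<close>. At level 0 the only index is 0, the root.\<close>
  define qk where "qk k x = (\<lambda>i. q x i div 2 ^ (K - k))" for k x
  have qk_box: "qk k \<in> cube_borel \<rightarrow>\<^sub>M count_space (cells k)" if "k \<le> K" for k
    unfolding qk_def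
  proof (rule measurable_compose[OF q])
    have "j i div 2 ^ (K - k) < 2 ^ k" if "j \<in> cells K" for j :: "'s \<Rightarrow> nat" and i
    proof -
      have "j i < 2 ^ k * 2 ^ (K - k)"
        using that \<open>k \<le> K\<close> by (simp add: cells_def flip: power_add)
      then show ?thesis by (simp add: less_mult_imp_div_less)
    qed
    then show "(\<lambda>j i. j i div 2 ^ (K - k)) \<in> count_space (cells K) \<rightarrow>\<^sub>M count_space (cells k :: ('s \<Rightarrow> nat) set)"
      by (simp add: measurable_count_space_eq1) (simp add: cells_def)
  qed
  have qk: "qk k \<in> P \<rightarrow>\<^sub>M count_space (cells k)" if "k \<le> K" for k
    using qk_box[OF that] PS(2) by (simp cong: measurable_cong_sets)
  have qk_parent: "qk k x = (\<lambda>i. qk (Suc k) x i div 2)" if "k < K" for k x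
  proof -
    have "K - k = Suc (K - Suc k)" using that by simp
    then show ?thesis by (simp add: qk_def div_mult2_eq power_Suc2 del: power_Suc)
  qed
  have qk_0: "qk 0 x = (\<lambda>_. 0)" if "x \<in> space P" for x
    using q_cells[of x] that by (auto simp: qk_def PS(3) cells_def)
  \<comment> \<open>Index shift: \<open>A k\<close>, \<open>V k\<close> and \<open>b k\<close>
    belong to the step from level \<open>k\<close> to \<open>Suc k\<close>, so the cells are those
    of level \<open>Suc k\<close>.\<close>
  define A where "A k j = qk (Suc k) -` {j} \<inter> unit_box" for k j
  have A_sets: "A k j \<in> sets cube_borel" if "k < K" "j \<in> cells (Suc k)" for k j
    using measurable_sets[OF qk_box, of "Suc k" "{j}"] that
    by (auto simp: A_def space_restrict_space)
  define b where "b k = M * ?s / 2 ^ Suc k" for k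
  have b0: "0 \<le> b k" for k using M by (simp add: b_def)
  define V where "V k j x = \<bar>measure P (A k j) - (\<Sum>i<n. indicator (A k j) (x i)) / real n\<bar>" for k j x
  \<comment> \<open>The right side of \<open>chaining\<close> for \<open>P\<close> and the empirical
    measure. The sample average of \<open>h\<close> has the same mean as the first term, whence the
    2 in the stated bound.\<close>
  define T where "T x = (\<integral>y. h y \<partial>P) + (\<Sum>i<n. h (x i)) / real n +
      (\<Sum>k<K. b k * (\<Sum>j\<in>cells (Suc k). V k j x))" for x
  have V_int: "integrable ?PM (V k j)" if "k < K" "j \<in> cells (Suc k)" for k j
    unfolding V_def
    by (rule expectation_empirical_deviation(1)[OF PS(1) _ n zero_less_one]) (use A_sets[OF that] PS(2) in simp)
  have V_sum: "(\<Sum>j\<in>cells (Suc k). \<integral>x. V k j x \<partial>?PM) \<le> sqrt (2 ^ (Suc k * CARD('s)) / real n)"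
    if "k < K" for k
  proof -
    have "(\<Sum>j\<in>cells (Suc k). \<integral>x. V k j x \<partial>?PM) \<le> sqrt (card (cells (Suc k) :: ('s \<Rightarrow> nat) set) / real n)"
      using expectation_empirical_partition[OF PS(1) finite_cells cells_nonempty qk[of "Suc k"] n] that
      by (simp add: V_def A_def PS(3))
    then show ?thesis by (simp only: card_cells) simp
  qed
  note h_comp = PiM_integral_component[OF PS(1) _ h_int[OF P]]
  have h_sum_int: "integrable ?PM (\<lambda>x. (\<Sum>i<n. h (x i)) / real n)"
    by (intro integrable_divide_zero Bochner_Integration.integrable_sum impI h_comp(1))
  have V_sum_int: "integrable ?PM (\<lambda>x. b k * (\<Sum>j\<in>cells (Suc k). V k j x))" if "k < K" for k
    by (intro integrable_mult_right Bochner_Integration.integrable_sum impI V_int[OF that])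
  have V_sum_int': "integrable ?PM (\<lambda>x. \<Sum>k<K. b k * (\<Sum>j\<in>cells (Suc k). V k j x))"
    using V_sum_int by (intro Bochner_Integration.integrable_sum) simp
  interpret PM: prob_space ?PM using PS(1) by (intro prob_space_PiM)
  have T_int: "integrable ?PM T"
    unfolding T_def by (intro Bochner_Integration.integrable_add h_sum_int V_sum_int') simp
  have T_E: "(\<integral>x. T x \<partial>?PM) \<le> 2 * ?D * (wass1 p P (gen_law U Gs) + M * ?s / 2 ^ K) +
      (\<Sum>k<K. M * ?s / 2 ^ Suc k * sqrt (2 ^ (Suc k * CARD('s)) / real n))"
  proof -
    have "(\<integral>x. T x \<partial>?PM) = (\<integral>y. h y \<partial>P) + (\<integral>x. (\<Sum>i<n. h (x i)) / real n \<partial>?PM)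
        + (\<integral>x. (\<Sum>k<K. b k * (\<Sum>j\<in>cells (Suc k). V k j x)) \<partial>?PM)"
      unfolding T_def using h_sum_int V_sum_int'
      by (subst Bochner_Integration.integral_add Bochner_Integration.integral_add; simp add: PM.prob_space)+
    also have "(\<integral>x. (\<Sum>i<n. h (x i)) / real n \<partial>?PM) = (\<integral>y. h y \<partial>P)"
    proof -
      have "(\<integral>x. (\<Sum>i<n. h (x i)) \<partial>?PM) = (\<Sum>i<n. \<integral>x. h (x i) \<partial>?PM)"
        by (rule Bochner_Integration.integral_sum) (rule h_comp(1))
      also have "\<dots> = (\<Sum>i<n. \<integral>y. h y \<partial>P)"
        by (rule sum.cong[OF refl]) (rule h_comp(2))
      finally show ?thesis using n by simp
    qed
    also have "(\<integral>x. (\<Sum>k<K. b k * (\<Sum>j\<in>cells (Suc k). V k j x)) \<partial>?PM)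
        = (\<Sum>k<K. b k * (\<Sum>j\<in>cells (Suc k). \<integral>x. V k j x \<partial>?PM))"
    proof -
      have "(\<integral>x. (\<Sum>k<K. b k * (\<Sum>j\<in>cells (Suc k). V k j x)) \<partial>?PM)
        = (\<Sum>k<K. \<integral>x. b k * (\<Sum>j\<in>cells (Suc k). V k j x) \<partial>?PM)"
        by (rule Bochner_Integration.integral_sum) (use V_sum_int in simp)
      also have "\<dots> = (\<Sum>k<K. b k * (\<Sum>j\<in>cells (Suc k). \<integral>x. V k j x \<partial>?PM))"
      proof (rule sum.cong[OF refl])
        fix k assume "k \<in> {..<K}"
        then have "(\<integral>x. (\<Sum>j\<in>cells (Suc k). V k j x) \<partial>?PM) = (\<Sum>j\<in>cells (Suc k). \<integral>x. V k j x \<partial>?PM)"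
          by (intro Bochner_Integration.integral_sum V_int) auto
        then show "(\<integral>x. b k * (\<Sum>j\<in>cells (Suc k). V k j x) \<partial>?PM)
            = b k * (\<Sum>j\<in>cells (Suc k). \<integral>x. V k j x \<partial>?PM)" by simp
      qed
      finally show ?thesis .
    qed
    also have "\<dots> \<le> (\<Sum>k<K. b k * sqrt (2 ^ (Suc k * CARD('s)) / real n))"
      using V_sum b0 by (intro sum_mono mult_left_mono) auto
    finally show ?thesis using h_E by (simp add: b_def)
  qed
  have T_ge: "wass1 p P (empirical n x) \<le> T x" if x: "x \<in> space ?PM" for x
  proof -
    have x_box: "x ` {..<n} \<subseteq> unit_box" using x by (auto simp: space_PiM PS(3))
    have Q: "cube_prob (empirical n x)" by (rule cube_prob_empirical[OF n x_box])
    have QS: "prob_space (empirical n x)" "sets (empirical n x) = sets P" by (simp_all add: cube_probD(1,2)[OF Q] PS(2))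
    have QA: "measure (empirical n x) (A k j) = (\<Sum>i<n. indicator (A k j) (x i)) / real n"
      if "k < K" "j \<in> cells (Suc k)" for k j
    proof -
      have "measure (empirical n x) (A k j) = (\<integral>y. indicator (A k j) y \<partial>empirical n x)"
        using A_sets[OF that] cube_probD[OF Q] by (simp add: A_def Int_assoc)
      also have "\<dots> = (\<Sum>i<n. indicator (A k j) (x i)) / real n"
        by (rule integral_empirical[OF x_box]) (use A_sets[OF that] in simp)
      finally show ?thesis .
    qed
    show ?thesis
    proof (rule wass1_le[OF p P Q])
      fix W :: "real^'d \<Rightarrow> real" assume W: "W \<in> lip_fun p 1 \<infinity>"
      have W_lip: "\<bar>W y - W z\<bar> \<le> lp_norm p (y - z)" if "y \<in> unit_box" "z \<in> unit_box" for y z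
        using W that unfolding lip_fun_def by fastforce
      have "(\<integral>y. W y \<partial>P) - (\<integral>y. W y \<partial>empirical n x) \<le> (\<integral>y. h y \<partial>P) + (\<integral>y. h y \<partial>empirical n x) +
          (\<Sum>k<K. b k * (\<Sum>j\<in>cells (Suc k). \<bar>measure P (qk (Suc k) -` {j} \<inter> space P) -
                                   measure (empirical n x) (qk (Suc k) -` {j} \<inter> space P)\<bar>))"
      \<comment> \<open>Approximating values are those of \<open>W\<close> at the images of cell
        centres. A step costs at most the distance of the images of nested centres, uniformly in
        \<open>W\<close>.\<close>
      proof (rule chaining[OF PS(1) QS, where F = "\<lambda>k j. W (S k j)" and par = "\<lambda>j i. j i div 2"])
        show "integrable P W" "integrable (empirical n x) W"
          using P Q integrable_lip_fun[OF p _ W] by auto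
        show "integrable P h" "integrable (empirical n x) h" using P Q h_int by auto
        fix k :: nat and j :: "'s \<Rightarrow> nat" assume k: "k < K" and j: "j \<in> cells (Suc k)"
        have j': "(\<lambda>i. j i div 2) \<in> cells k" using j by (auto simp: cells_def less_mult_imp_div_less mult.commute)
        have "\<bar>W (S (Suc k) j) - W (S k (\<lambda>i. j i div 2))\<bar> \<le> lp_norm p (S (Suc k) j - S k (\<lambda>i. j i div 2))"
          by (rule W_lip[OF S_box[OF j] S_box[OF j']])
        also have "\<dots> \<le> M * ?s * infnorm (cell_center (Suc k) j - cell_center k (\<lambda>i. j i div 2))"
          unfolding S_def
          by (rule lip_maps_infnorm[OF p M Gs cell_center_in_box[OF j] cell_center_in_box[OF j']])
        also have "\<dots> \<le> M * ?s * (1 / 2 ^ Suc k)"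
          using M cell_center_parent by (intro mult_left_mono) auto
        finally show "\<bar>W (S (Suc k) j) - W (S k (\<lambda>i. j i div 2))\<bar> \<le> b k" by (simp add: b_def)
      next
        fix y assume "y \<in> space P"
        then have y: "y \<in> unit_box" by (simp add: PS(3))
        have "\<bar>W y - W (S K (qk K y))\<bar> \<le> lp_norm p (y - S K (q y))"
          using W_lip[OF y S_box[OF q_cells[OF y]]] by (simp add: qk_def)
        also have "\<dots> \<le> h y"
          unfolding h_def m_def f_def by (rule lp_norm_le_infnorm[OF p])
        finally show "\<bar>W y - W (S K (qk K y))\<bar> \<le> h y" .
      qed (use finite_cells qk qk_parent qk_0 in auto)
      also have "(\<integral>y. h y \<partial>empirical n x) = (\<Sum>i<n. h (x i)) / real n"
        by (rule integral_empirical[OF x_box h_meas])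
      also have "(\<Sum>k<K. b k * (\<Sum>j\<in>cells (Suc k). \<bar>measure P (qk (Suc k) -` {j} \<inter> space P) -
                                   measure (empirical n x) (qk (Suc k) -` {j} \<inter> space P)\<bar>))
          = (\<Sum>k<K. b k * (\<Sum>j\<in>cells (Suc k). V k j x))"
        using QA by (intro sum.cong refl arg_cong2[where f="(*)"]) (auto simp: V_def A_def PS(3))
      finally show "(\<integral>y. W y \<partial>P) - (\<integral>y. W y \<partial>empirical n x) \<le> T x" by (simp add: T_def)
    qed
  qed
  show ?thesis using T_int T_ge T_E by blast
qed

section \<open>The rate of convergence\<close>

lemma ex_dyadic_scale:
  fixes x :: real
  assumes "1 \<le> x"
  shows "\<exists>K::nat. 2 ^ K \<le> x \<and> x < 2 * 2 ^ K"
proof -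
  define K where "K = nat \<lfloor>log 2 x\<rfloor>"
  have "0 \<le> log 2 x" using assms by simp
  then have K: "real K \<le> log 2 x" "log 2 x < real K + 1" by (simp_all add: K_def)
  have x: "x = 2 powr (log 2 x)" using assms by simp
  have "2 powr real K \<le> x" using K(1) by (subst x) (rule powr_mono, auto)
  moreover have "x < 2 powr (real K + 1)" using K(2) by (subst x) (rule powr_less_mono, auto)
  ultimately show ?thesis by (intro exI[of _ K]) (simp add: powr_add powr_realpow)
qed

text \<open>The part of the empirical bound governed by \<open>n\<close> and the depth
  \<open>K\<close>, freed of its factors: the mesh size plus a sampling error for each level. The
  depth is chosen to balance them.\<close>

definition chain_sum :: "nat \<Rightarrow> nat \<Rightarrow> nat \<Rightarrow> real" where
  "chain_sum s n K = 1 / 2 ^ K + (\<Sum>k<K. 1 / 2 ^ Suc k * sqrt (2 ^ (Suc k * s) / real n))"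

text \<open>The ratio is 2 to the power s / 2 - 1: below 1, equal to 1 or above 1 according to s =
  1, s = 2 or s > 2. This is the origin of the three cases of \<open>rate\<close>.\<close>

lemma chain_sum_geometric:
  "chain_sum s n K = 1 / 2 ^ K + (\<Sum>k<K. (sqrt (2 ^ s) / 2) ^ Suc k) / sqrt n"
proof -
  have "1 / 2 ^ Suc k * sqrt (2 ^ (Suc k * s) / real n) = (sqrt (2 ^ s) / 2) ^ Suc k / sqrt n" for k
    unfolding real_sqrt_divide power_divide mult.commute[of "Suc k" s] power_mult real_sqrt_power[symmetric]
    by simp
  then show ?thesis unfolding chain_sum_def by (simp only: sum_divide_distrib)
qed

lemma rate_squared:
  assumes "1 \<le> n"
  shows "(rate s n)\<^sup>2 = (if s > 2 then n powr (- 1 / s) else if s = 2 then ln n / sqrt n else 1 / sqrt n)"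
proof -
  have sq: "(real n powr a)\<^sup>2 = real n powr (2 * a)" for a
    by (simp add: power2_eq_square flip: powr_add)
  have half: "(real n powr (- 1 / 4))\<^sup>2 = 1 / sqrt n"
  proof -
    have "(real n powr (- 1 / 4))\<^sup>2 = real n powr - (1 / 2)" unfolding sq by simp
    also have "\<dots> = 1 / sqrt n" by (simp add: powr_minus_divide powr_half_sqrt)
    finally show ?thesis .
  qed
  consider "s > 2" | "s = 2" | "s < 2" by linarith
  then show ?thesis
  proof cases
    case 1
    then show ?thesis by (simp add: rate_def sq)
  next
    case 2
    have "(sqrt (ln n))\<^sup>2 = ln n" using assms by simp
    then have "(real n powr (- 1 / 4) * sqrt (ln n))\<^sup>2 = 1 / sqrt n * ln n"
      by (simp only: power_mult_distrib half)
    with 2 show ?thesis by (simp add: rate_def)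
  next
    case 3
    then show ?thesis using half by (simp add: rate_def)
  qed
qed

text \<open>For s = 1 the coarse levels dominate, for s = 2 all levels weigh the same and their
  number gives the logarithm, for s > 2 the finest level dominates. At s = 2 and n = 1 the rate is 0
  but \<open>chain_sum\<close> is positive, hence \<open>2 \<le> n\<close>.\<close>

lemma ex_chain_sum_le_rate:
  assumes "1 \<le> s"
  shows "\<exists>C>0. \<forall>n\<ge>1. (s = 2 \<longrightarrow> 2 \<le> n) \<longrightarrow> (\<exists>K. chain_sum s n K \<le> C * (rate s n)\<^sup>2)"
proof -
  define b :: real where "b = sqrt (2 ^ s) / 2"
  consider "s = 1" | "s = 2" | "s > 2" using assms by linarith
  then show ?thesis
  proof cases
    case 1
    have b: "0 < b" "b < 1" using 1 real_sqrt_less_mono[of 2 4] by (auto simp: b_def)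
    show ?thesis
    \<comment> \<open>The fraction bounds the geometric series at every depth, so the generous depth
      \<open>K = n\<close> serves; it brings the mesh below \<open>1 / sqrt n\<close>.\<close>
    proof (intro exI[of _ "1 + b / (1 - b)"] conjI allI impI)
      show "0 < 1 + b / (1 - b)" using b by (simp add: add_pos_pos)
      fix n :: nat assume n: "1 \<le> n"
      have "sqrt n \<le> real n" using n by (intro real_le_lsqrt) (auto simp: power2_eq_square)
      also have "real n \<le> 2 ^ n" using of_nat_less_two_power[of n] by simp
      finally have "1 / 2 ^ n \<le> 1 / sqrt n" using n by (intro divide_left_mono) auto
      moreover have "(\<Sum>k<n. b ^ Suc k) \<le> b / (1 - b)"
      proof -
        have "(\<Sum>k<n. b ^ Suc k) = b * (\<Sum>k<n. b ^ k)" by (simp add: sum_distrib_left)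
        also have "(\<Sum>k<n. b ^ k) = (1 - b ^ n) / (1 - b)" using b by (simp add: sum_gp_strict)
        also have "b * ((1 - b ^ n) / (1 - b)) \<le> b * (1 / (1 - b))"
          using b by (intro mult_left_mono divide_right_mono) auto
        finally show ?thesis by simp
      qed
      then have "(\<Sum>k<n. b ^ Suc k) / sqrt n \<le> b / (1 - b) / sqrt n"
        by (rule divide_right_mono) simp
      ultimately have "chain_sum s n n \<le> 1 / sqrt n + b / (1 - b) / sqrt n"
        unfolding chain_sum_geometric b_def[symmetric] by (rule add_mono)
      also have "\<dots> = (1 + b / (1 - b)) * (1 / sqrt n)"
        by (simp only: add_divide_distrib times_divide_eq_right mult_1_right)
      also have "1 / sqrt n = (rate s n)\<^sup>2" using 1 rate_squared[OF n] by simp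
      finally show "\<exists>K. chain_sum s n K \<le> (1 + b / (1 - b)) * (rate s n)\<^sup>2" by blast
    qed
  next
    case 2
    have b: "b = 1" by (simp add: b_def 2)
    show ?thesis
    \<comment> \<open>Of the 3, two come from the mesh, where \<open>ln n / ln 2 \<ge> 1\<close>
      inserts the logarithm, and one from at most \<open>ln n / ln 2\<close> levels of weight
      \<open>1 / sqrt n\<close>.\<close>
    proof (intro exI[of _ "3 / ln 2"] conjI allI impI)
      show "0 < 3 / ln (2 :: real)" by simp
      fix n :: nat assume n: "1 \<le> n" and "s = 2 \<longrightarrow> 2 \<le> n"
      then have n2: "2 \<le> n" using 2 by simp
      obtain K where K: "2 ^ K \<le> real n" "real n < 2 * 2 ^ K"
        using ex_dyadic_scale[of n] n by auto
      have sn: "0 < sqrt n" "sqrt n * sqrt n = n" using n by auto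
      have ln2: "0 < ln (2 :: real)" "ln 2 \<le> ln (real n)" using n2 by auto
      have "ln (2 ^ K) \<le> ln (real n)" using K(1) n by (subst ln_le_cancel_iff) auto
      then have Kle: "real K \<le> ln n / ln 2" using ln2 by (simp add: ln_realpow pos_le_divide_eq)
      have "1 / 2 ^ K \<le> 2 / real n" using K n by (simp add: divide_simps)
      also have "\<dots> = 2 / sqrt n / sqrt n" using sn by (simp add: divide_simps)
      also have "\<dots> \<le> 2 / sqrt n / 1" using n by (intro divide_left_mono) auto
      also have "\<dots> = 2 * 1 / sqrt n" by simp
      also have "\<dots> \<le> 2 * (ln n / ln 2) / sqrt n"
        using ln2 by (intro divide_right_mono mult_left_mono) auto
      finally have "1 / 2 ^ K \<le> 2 * (ln n / ln 2) / sqrt n" by simp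
      moreover have "(\<Sum>k<K. b ^ Suc k) / sqrt n \<le> (ln n / ln 2) / sqrt n"
        using Kle by (intro divide_right_mono) (auto simp: b)
      ultimately have "chain_sum s n K \<le> 2 * (ln n / ln 2) / sqrt n + (ln n / ln 2) / sqrt n"
        unfolding chain_sum_geometric b_def[symmetric] by (rule add_mono)
      also have "\<dots> = 3 / ln 2 * (ln n / sqrt n)" by (simp add: add_divide_distrib[symmetric])
      also have "ln n / sqrt n = (rate s n)\<^sup>2" using 2 rate_squared[OF n] by simp
      finally show "\<exists>K. chain_sum s n K \<le> 3 / ln 2 * (rate s n)\<^sup>2" by blast
    qed
  next
    case 3
    have "sqrt (2 ^ 2) < sqrt (2 ^ s)" using 3 by (intro real_sqrt_less_mono power_strict_increasing) auto
    then have b: "1 < b" by (simp add: b_def)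
    show ?thesis
    proof (intro exI[of _ "2 * (1 + b / (b - 1))"] conjI allI impI)
      show "0 < 2 * (1 + b / (b - 1))" using b by (simp add: add_pos_pos)
      fix n :: nat assume n: "1 \<le> n"
      \<comment> \<open>At mesh 1/x the grid would have n cells and the sampling error of the finest
        level would equal the mesh. Rounding x to a power of 2 costs the factor 2 in the
        constant.\<close>
      define x where "x = real n powr (1 / s)"
      have "1 \<le> x" using n by (simp add: x_def ge_one_powr_ge_zero)
      then obtain K where K: "2 ^ K \<le> x" "x < 2 * 2 ^ K" using ex_dyadic_scale by blast
      have xs: "x ^ s = n"
      proof -
        have "x ^ s = x powr real s" using \<open>1 \<le> x\<close> by (intro powr_realpow[symmetric]) simp
        also have "\<dots> = n" using n 3 by (simp add: x_def powr_powr)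
        finally show ?thesis .
      qed
      have bK: "b ^ K \<le> sqrt n / 2 ^ K"
      proof -
        have "(2 ^ K) ^ s \<le> x ^ s" using K(1) by (rule power_mono) simp
        then have "sqrt ((2 ^ K) ^ s) \<le> sqrt n" unfolding xs by (rule real_sqrt_le_mono)
        moreover have "b ^ K = sqrt ((2 ^ K) ^ s) / 2 ^ K"
        proof -
          have "((2 :: real) ^ s) ^ K = (2 ^ K) ^ s" by (metis mult.commute power_mult)
          then show ?thesis by (simp only: b_def power_divide real_sqrt_power[symmetric])
        qed
        ultimately show ?thesis by (simp add: divide_right_mono)
      qed
      have "(\<Sum>k<K. b ^ Suc k) \<le> b / (b - 1) * b ^ K"
      proof -
        have "(\<Sum>k<K. b ^ Suc k) = b * (\<Sum>k<K. b ^ k)" by (simp add: sum_distrib_left)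
        also have "(\<Sum>k<K. b ^ k) = (b ^ K - 1) / (b - 1)" using b by (simp add: geometric_sum)
        also have "b * ((b ^ K - 1) / (b - 1)) \<le> b * (b ^ K / (b - 1))"
          using b by (intro mult_left_mono divide_right_mono) auto
        finally show ?thesis by simp
      qed
      also have "\<dots> \<le> b / (b - 1) * (sqrt n / 2 ^ K)"
        using b bK by (intro mult_left_mono) auto
      finally have "(\<Sum>k<K. b ^ Suc k) / sqrt n \<le> b / (b - 1) * (sqrt n / 2 ^ K) / sqrt n"
        by (rule divide_right_mono) simp
      also have "\<dots> = b / (b - 1) * (1 / 2 ^ K)" using n by simp
      finally have "chain_sum s n K \<le> 1 / 2 ^ K + b / (b - 1) * (1 / 2 ^ K)"
        unfolding chain_sum_geometric b_def[symmetric] by (rule add_left_mono)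
      also have "\<dots> = (1 + b / (b - 1)) * (1 / 2 ^ K)"
        by (simp only: distrib_right mult_1_left)
      also have "\<dots> \<le> (1 + b / (b - 1)) * (2 / x)"
      proof (rule mult_left_mono)
        show "1 / 2 ^ K \<le> 2 / x" using K \<open>1 \<le> x\<close> by (simp add: divide_simps)
      qed (use b in simp)
      also have "\<dots> = 2 * (1 + b / (b - 1)) * (real n powr (- 1 / s))"
        by (simp add: x_def powr_minus divide_inverse)
      also have "real n powr (- 1 / s) = (rate s n)\<^sup>2" using 3 rate_squared[OF n] by simp
      finally show "\<exists>K. chain_sum s n K \<le> 2 * (1 + b / (b - 1)) * (rate s n)\<^sup>2" by blast
    qed
  qed
qed

section \<open>The oracle inequality\<close>

text \<open>The tangent of the square root at the point with root \<open>r\<close>. Being affine in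
  \<open>t\<close>, it can be integrated term by term.\<close>

lemma sqrt_le_linear: "0 \<le> t \<Longrightarrow> 0 < r \<Longrightarrow> sqrt t \<le> t / (2 * r) + r / 2"
proof -
  assume "0 \<le> t" "0 < r"
  have "0 \<le> (sqrt t - r)\<^sup>2" by simp
  then have "2 * r * sqrt t \<le> t + r\<^sup>2" using \<open>0 \<le> t\<close> by (simp add: power2_diff mult.commute mult.left_commute)
  then have "2 * r * sqrt t / (2 * r) \<le> (t + r\<^sup>2) / (2 * r)"
    using \<open>0 < r\<close> by (intro divide_right_mono) auto
  then show ?thesis using \<open>0 < r\<close> by (simp add: add_divide_distrib power2_eq_square)
qed

lemma sqrt_le_bracket: "sqrt x \<le> bracket x"
  by (simp add: bracket_def)

text \<open>The infimum is moved under the root by squaring, which needs \<open>X > 0\<close>. In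
  its application \<open>X\<close> is a difference and may be negative; then the sign alone
  decides.\<close>

lemma le_sqrt_INF:
  fixes f :: "'a \<Rightarrow> real"
  assumes "A \<noteq> {}" "0 < c" "\<And>a. a \<in> A \<Longrightarrow> 0 \<le> f a" "\<And>a. a \<in> A \<Longrightarrow> X \<le> c * sqrt (f a)"
  shows "X \<le> c * sqrt (INF a\<in>A. f a)"
proof (cases "X \<le> 0")
  case True
  have "0 \<le> (INF a\<in>A. f a)" using assms by (intro cINF_greatest)
  then have "0 \<le> c * sqrt (INF a\<in>A. f a)" using assms(2) by simp
  with True show ?thesis by linarith
next
  case False
  have "(X / c)\<^sup>2 \<le> (INF a\<in>A. f a)"
  proof (rule cINF_greatest[OF assms(1)])
    fix a assume a: "a \<in> A"
    have "X / c \<le> sqrt (f a)" using assms(4)[OF a] assms(2) by (simp add: pos_divide_le_eq mult.commute)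
    then have "(X / c)\<^sup>2 \<le> (sqrt (f a))\<^sup>2" using False assms(2) by (intro power_mono) auto
    then show "(X / c)\<^sup>2 \<le> f a" using assms(3)[OF a] by simp
  qed
  then have "X / c \<le> sqrt (INF a\<in>A. f a)" by (rule real_le_rsqrt)
  then show ?thesis using assms(2) by (simp add: pos_divide_le_eq mult.commute)
qed

lemma rate_pos:
  assumes "1 \<le> n" "s = 2 \<longrightarrow> 2 \<le> n"
  shows "0 < rate s n"
  using assms by (auto simp: rate_def)

lemma sup_dist_nonneg:
  fixes G H :: "real^'s::finite \<Rightarrow> real^'d::finite"
  assumes "1 \<le> p" "G \<in> unit_box \<rightarrow> unit_box" "H \<in> unit_box \<rightarrow> unit_box"
  shows "0 \<le> sup_dist p G H"
  using lp_norm_le_sup_dist[OF assms unit_box_half] lp_norm_nonneg by (rule order_trans[rotated])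

text \<open>
  The minimiser is only compared with competitors at the empirical measure; \<open>A\<close> enters through
  \<open>sqrt A\<close> because it is bounded by the dimension.
\<close>

lemma erm_pointwise_bound:
  fixes P Pn :: "(real^'d::finite) measure" and U :: "(real^'s::finite) measure"
  assumes p: "1 \<le> p" and L: "1 \<le> L" and B: "1 \<le> B"
    and P: "cube_prob P" and Pn: "cube_prob Pn" and U: "cube_prob U"
    and Gh: "Gh \<in> cube_borel \<rightarrow>\<^sub>M cube_borel" and G: "G \<in> cube_borel \<rightarrow>\<^sub>M cube_borel"
    and Gs: "Gs \<in> cube_borel \<rightarrow>\<^sub>M cube_borel"
    and opt: "gan_val (lip_fun p L B) Pn (gen_law U Gh) \<le> gan_val (lip_fun p L B) Pn (gen_law U G)"
    and T: "wass1 p P Pn \<le> T"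
  shows "wass1 p P (gen_law U Gh)
    \<le> 3 * real CARD('d) * L * sqrt (T + wass1 p P (gen_law U Gs) + sup_dist p G Gs)"
proof -
  let ?D = "real CARD('d)" and ?A = "wass1 p P Pn" and ?w = "wass1 p P (gen_law U Gs)"
  let ?Y = "T + ?w + sup_dist p G Gs"
  note lGh = cube_prob_gen_law[OF U Gh] and lG = cube_prob_gen_law[OF U G] and lGs = cube_prob_gen_law[OF U Gs]
  have D1: "1 \<le> ?D" by (simp add: Suc_le_eq)
  have A0: "0 \<le> ?A" by (rule wass1_nonneg[OF p P Pn])
  have w0: "0 \<le> ?w" by (rule wass1_nonneg[OF p P lGs])
  have s0: "0 \<le> sup_dist p G Gs"
    by (rule sup_dist_nonneg[OF p measurable_cube_maps[OF G] measurable_cube_maps[OF Gs]])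
  have B0: "0 \<le> B" using B by (rule order_trans[rotated]) simp
  have "wass1 p Pn (gen_law U G) \<le> wass1 p Pn P + (?w + wass1 p (gen_law U Gs) (gen_law U G))"
    using wass1_triangle[OF p Pn P lG] wass1_triangle[OF p P lGs lG] by linarith
  also have "wass1 p Pn P = ?A" by (rule wass1_commute[OF p Pn P])
  also have "wass1 p (gen_law U Gs) (gen_law U G) \<le> sup_dist p G Gs"
    unfolding wass1_commute[OF p lGs lG] by (rule wass1_gen_law_le_sup_dist[OF p U G Gs])
  finally have Y: "wass1 p Pn (gen_law U G) \<le> ?Y" using T by simp
  have "wass1 p Pn (gen_law U Gh) \<le> 2 * ?D * sqrt (gan_val (lip_fun p L B) Pn (gen_law U Gh))"
    by (rule wass1_le_sqrt_gan_val(2)[OF p Pn lGh L B])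
  \<comment> \<open>Optimality enters here, at the empirical measure, followed by
    \<open>V \<le> L * wass1\<close> for the competitor. A second factor \<open>L \<ge> 1\<close> is
    inserted so that the root returns \<open>L\<close> itself.\<close>
  also have "\<dots> \<le> 2 * ?D * sqrt (L\<^sup>2 * ?Y)"
  proof (intro mult_left_mono real_sqrt_le_mono)
    have "gan_val (lip_fun p L B) Pn (gen_law U G) \<le> L * wass1 p Pn (gen_law U G)"
      using L B0 by (intro gan_val_le_wass1 p Pn lG) auto
    also have "\<dots> \<le> L\<^sup>2 * ?Y"
      unfolding power2_eq_square
      using L Y wass1_nonneg[OF p Pn lG] by (intro mult_mono) (auto simp: mult_le_cancel_left1)
    finally show "gan_val (lip_fun p L B) Pn (gen_law U Gh) \<le> L\<^sup>2 * ?Y" using opt by simp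
  qed simp
  also have "\<dots> = 2 * ?D * L * sqrt ?Y" using L by (simp add: real_sqrt_mult)
  finally have 1: "wass1 p Pn (gen_law U Gh) \<le> 2 * ?D * L * sqrt ?Y" .
  have "?A = sqrt ?A * sqrt ?A" using A0 by simp
  also have "\<dots> \<le> (?D * L) * sqrt ?Y"
  proof (rule mult_mono)
    have "?A \<le> ?D" by (rule wass1_le_card[OF p P Pn])
    also have "?D * 1 \<le> ?D * ?D" using D1 by (intro mult_left_mono) auto
    finally have "sqrt ?A \<le> ?D" using D1 by (intro real_le_lsqrt) (auto simp: power2_eq_square)
    also have "?D * 1 \<le> ?D * L" using L by (intro mult_left_mono) auto
    finally show "sqrt ?A \<le> ?D * L" by simp
    show "sqrt ?A \<le> sqrt ?Y" using T w0 s0 by simp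
  qed (use A0 L in auto)
  finally have "?A \<le> ?D * L * sqrt ?Y" .
  \<comment> \<open>The constant 3 is 2 for the distance from \<open>Pn\<close> to the learned law
    plus 1 for the distance from \<open>P\<close> to \<open>Pn\<close>.\<close>
  with 1 wass1_triangle[OF p P Pn lGh] show ?thesis by (simp add: algebra_simps)
qed

text \<open>The pointwise bound is made affine in \<open>T\<close> by the tangent touching at
  \<open>Y\<close>, a bound for the mean radicand; integration then gives a multiple of
  \<open>sqrt Y\<close>. Subadditivity of the root splits it into three terms, and \<open>c\<close>
  contains the sum of their coefficients.\<close>

lemma erm_expectation_bound:
  fixes P :: "(real^'d::finite) measure" and U :: "(real^'s::finite) measure"
  assumes p: "1 \<le> p" and L: "1 \<le> L" and M: "0 < M" and C: "0 < C" and B: "1 \<le> B"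
    and P: "cube_prob P" and U: "cube_prob U" and n: "1 \<le> n"
    and K: "chain_sum CARD('s) n K \<le> C * (rate CARD('s) n)\<^sup>2" and rate: "0 < rate CARD('s) n"
    and \<G>: "\<G> \<subseteq> meas_maps" and erm: "is_erm (lip_fun p L B) \<G> P U n Gh"
    and G: "G \<in> \<G>" and Gs: "Gs \<in> lip_maps p M"
  defines "c \<equiv> 3 * real CARD('d) * L * (3 * real CARD('d) + sqrt (2 * real CARD('d) * (M * real CARD('s)) * C) + 1)"
  shows "(\<integral>x. wass1 p P (gen_law U (Gh x)) \<partial>(\<Pi>\<^sub>M i\<in>{..<n}. P))
    \<le> c * sqrt (wass1 p P (gen_law U Gs)) + c * sqrt (sup_dist p G Gs) + c * rate CARD('s) n"
proof -
  let ?PM = "\<Pi>\<^sub>M i\<in>{..<n}. P" and ?D = "real CARD('d)" and ?s = "real CARD('s)"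
  let ?w = "wass1 p P (gen_law U Gs)" and ?\<delta> = "sup_dist p G Gs" and ?r = "rate CARD('s) n"
  interpret PM: prob_space ?PM using cube_probD(1)[OF P] by (intro prob_space_PiM)
  define \<kappa> where "\<kappa> = 2 * ?D * (M * ?s) * C"
  define b where "b = 3 * ?D * L"
  have D1: "1 \<le> ?D" by (simp add: Suc_le_eq)
  have b0: "0 < b" using L D1 by (simp add: b_def)
  have \<kappa>0: "0 < \<kappa>" using M C by (simp add: \<kappa>_def)
  have Gs_meas: "Gs \<in> cube_borel \<rightarrow>\<^sub>M cube_borel" using lip_maps_measurable[OF p _ Gs] M by simp
  have \<G>_meas: "H \<in> cube_borel \<rightarrow>\<^sub>M cube_borel" if "H \<in> \<G>" for H
    using \<G> that by (auto simp: meas_maps_def)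
  have lGs: "cube_prob (gen_law U Gs)" by (rule cube_prob_gen_law[OF U Gs_meas])
  have w0: "0 \<le> ?w" by (rule wass1_nonneg[OF p P lGs])
  have \<delta>0: "0 \<le> ?\<delta>"
    by (rule sup_dist_nonneg[OF p measurable_cube_maps[OF \<G>_meas[OF G]] measurable_cube_maps[OF Gs_meas]])
  obtain T where T: "integrable ?PM T" "\<And>x. x \<in> space ?PM \<Longrightarrow> wass1 p P (empirical n x) \<le> T x"
    and ET: "(\<integral>x. T x \<partial>?PM) \<le> 2 * ?D * (?w + M * ?s / 2 ^ K) +
      (\<Sum>k<K. M * ?s / 2 ^ Suc k * sqrt (2 ^ (Suc k * CARD('s)) / real n))"
    using wass1_empirical_bound[OF p less_imp_le[OF M] P U Gs n, of K] by blast
  \<comment> \<open>Two of the three \<open>?D * ?w\<close> come from the projection error in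
    \<open>T\<close>, the third absorbs the separate \<open>?w\<close>. The positive rate makes
    \<open>Y\<close> positive, as a point of tangency must be.\<close>
  define Y where "Y = 3 * ?D * ?w + \<kappa> * ?r\<^sup>2 + ?\<delta>"
  have Y0: "0 < Y" using w0 \<delta>0 \<kappa>0 rate unfolding Y_def by (intro add_pos_nonneg add_nonneg_pos) auto
  have ETY: "(\<integral>x. T x \<partial>?PM) + ?w + ?\<delta> \<le> Y"
  proof -
    let ?S = "\<Sum>k<K. 1 / 2 ^ Suc k * sqrt (2 ^ (Suc k * CARD('s)) / real n)"
    have "(\<Sum>k<K. M * ?s / 2 ^ Suc k * sqrt (2 ^ (Suc k * CARD('s)) / real n)) = M * ?s * ?S"
      by (simp add: sum_distrib_left)
    \<comment> \<open>The level sum is inflated to the factor of the mesh term, so that both join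
      into \<open>chain_sum\<close>.\<close>
    also have "\<dots> \<le> (2 * ?D) * (M * ?s * ?S)"
    proof -
      have "0 \<le> M * ?s * ?S" using M by (intro mult_nonneg_nonneg sum_nonneg) auto
      then have "1 * (M * ?s * ?S) \<le> (2 * ?D) * (M * ?s * ?S)" using D1 by (intro mult_right_mono) linarith+
      then show ?thesis by simp
    qed
    finally have "(\<integral>x. T x \<partial>?PM) \<le> 2 * ?D * (?w + M * ?s / 2 ^ K) + (2 * ?D) * (M * ?s * ?S)"
      using ET by linarith
    also have "\<dots> = 2 * ?D * ?w + 2 * ?D * (M * ?s) * chain_sum CARD('s) n K"
      by (simp add: chain_sum_def distrib_left)
    also have "\<dots> \<le> 2 * ?D * ?w + 2 * ?D * (M * ?s) * (C * ?r\<^sup>2)"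
      using M K by (intro add_left_mono mult_left_mono) auto
    finally have "(\<integral>x. T x \<partial>?PM) \<le> 2 * ?D * ?w + \<kappa> * ?r\<^sup>2" by (simp add: \<kappa>_def mult.assoc)
    moreover have "?w \<le> ?D * ?w" using D1 w0 by (simp add: mult_le_cancel_right1)
    ultimately show ?thesis by (simp add: Y_def)
  qed
  have pointwise: "0 \<le> wass1 p P (gen_law U (Gh x)) \<and>
      wass1 p P (gen_law U (Gh x)) \<le> b * ((T x + ?w + ?\<delta>) / (2 * sqrt Y) + sqrt Y / 2)"
    if x: "x \<in> space ?PM" for x
  proof -
    have x_box: "x ` {..<n} \<subseteq> unit_box" using x by (auto simp: space_PiM cube_probD(3)[OF P])
    note Pn = cube_prob_empirical[OF n x_box]
    have am: "is_arg_min (\<lambda>G. gan_val (lip_fun p L B) (empirical n x) (gen_law U G)) (\<lambda>G. G \<in> \<G>) (Gh x)"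
      using erm x by (simp add: is_erm_def)
    then have Ghx: "Gh x \<in> \<G>"
      and opt: "gan_val (lip_fun p L B) (empirical n x) (gen_law U (Gh x)) \<le>
        gan_val (lip_fun p L B) (empirical n x) (gen_law U G)"
      using G by (auto simp: is_arg_min_linorder)
    have "0 \<le> wass1 p P (empirical n x)" by (rule wass1_nonneg[OF p P Pn])
    then have T0: "0 \<le> T x" using T(2)[OF x] by linarith
    have "wass1 p P (gen_law U (Gh x)) \<le> b * sqrt (T x + ?w + ?\<delta>)"
      unfolding b_def
      by (rule erm_pointwise_bound[OF p L B P Pn U \<G>_meas[OF Ghx] \<G>_meas[OF G] Gs_meas opt T(2)[OF x]])
    also have "\<dots> \<le> b * ((T x + ?w + ?\<delta>) / (2 * sqrt Y) + sqrt Y / 2)"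
      using b0 T0 w0 \<delta>0 Y0 by (intro mult_left_mono sqrt_le_linear) auto
    finally show ?thesis
      using wass1_nonneg[OF p P cube_prob_gen_law[OF U \<G>_meas[OF Ghx]]] by simp
  qed
  have "(\<integral>x. wass1 p P (gen_law U (Gh x)) \<partial>?PM)
      \<le> (\<integral>x. b * ((T x + ?w + ?\<delta>) / (2 * sqrt Y) + sqrt Y / 2) \<partial>?PM)"
    using pointwise T(1) by (intro integral_mono') (auto intro: order_trans)
  also have "\<dots> = b * (((\<integral>x. T x \<partial>?PM) + ?w + ?\<delta>) / (2 * sqrt Y) + sqrt Y / 2)"
    using T(1) by (simp add: PM.prob_space)
  also have "\<dots> \<le> b * (Y / (2 * sqrt Y) + sqrt Y / 2)"
    using b0 Y0 ETY by (intro mult_left_mono add_right_mono divide_right_mono) auto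
  also have "Y / (2 * sqrt Y) = sqrt Y / 2" using Y0 by (simp add: real_div_sqrt field_simps)
  also have "b * (sqrt Y / 2 + sqrt Y / 2) = b * sqrt Y" by simp
  also have "\<dots> \<le> b * (3 * ?D * sqrt ?w + sqrt \<kappa> * ?r + sqrt ?\<delta>)"
  proof (rule mult_left_mono)
    have "sqrt Y \<le> sqrt (3 * ?D * ?w) + sqrt (\<kappa> * ?r\<^sup>2) + sqrt ?\<delta>"
      unfolding Y_def using w0 \<delta>0 \<kappa>0
      by (intro order_trans[OF sqrt_add_le_add_sqrt] add_right_mono sqrt_add_le_add_sqrt) auto
    moreover have "sqrt (\<kappa> * ?r\<^sup>2) = sqrt \<kappa> * ?r" using rate by (simp add: real_sqrt_mult)
    moreover have "sqrt (3 * ?D * ?w) \<le> 3 * ?D * sqrt ?w"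
    proof -
      have "1 \<le> 3 * ?D" using D1 by linarith
      then have "3 * ?D \<le> (3 * ?D)\<^sup>2" by (rule self_le_power) simp
      then have "sqrt (3 * ?D) \<le> 3 * ?D" by (rule real_le_lsqrt[rotated]) simp
      then show ?thesis using w0 by (simp add: real_sqrt_mult mult_right_mono)
    qed
    ultimately show "sqrt Y \<le> 3 * ?D * sqrt ?w + sqrt \<kappa> * ?r + sqrt ?\<delta>" by linarith
  qed (use b0 in simp)
  also have "\<dots> \<le> c * sqrt ?w + c * sqrt ?\<delta> + c * ?r"
  proof -
    have c: "c = b * (3 * ?D + sqrt \<kappa> + 1)" by (simp add: c_def b_def \<kappa>_def)
    have "b * (3 * ?D) \<le> c" "b * sqrt \<kappa> \<le> c" "b * 1 \<le> c"
      unfolding c using b0 \<kappa>0 by (auto intro!: mult_left_mono)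
    then have "b * (3 * ?D) * sqrt ?w \<le> c * sqrt ?w" "b * sqrt \<kappa> * ?r \<le> c * ?r" "b * 1 * sqrt ?\<delta> \<le> c * sqrt ?\<delta>"
      using w0 \<delta>0 rate by (auto intro!: mult_right_mono)
    then show ?thesis by (simp add: distrib_left mult.assoc)
  qed
  finally show ?thesis .
qed

lemma lip_maps_nonempty:
  assumes "0 \<le> M"
  shows "lip_maps p M \<noteq> ({} :: (real^'s::finite \<Rightarrow> real^'d::finite) set)"
proof -
  let ?G = "\<lambda>z\<in>unit_box. (\<chi> i. 1 / 2) :: real^'d"
  have "lp_norm p (0 :: real^'d) \<le> 0"
    by (simp add: lp_norm_def infnorm_0)
  then have "?G \<in> lip_maps p M"
    using unit_box_half assms
    by (auto simp: lip_maps_def intro: order_trans[OF _ mult_nonneg_nonneg[OF _ lp_norm_nonneg]])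
  then show ?thesis by blast
qed

text \<open>The constant is quantified before the bound \<open>B\<close>, the laws, the class, the
  sample size and the minimiser, so it is uniform in them. Measurability of the loss makes the outer
  integral a genuine expectation instead of the default value 0 of a non-integrable function. For
  latent dimension 2 the rate vanishes at n = 1, hence \<open>2 \<le> n\<close>.\<close>

theorem theorem4p3:
  fixes p :: ereal and L M :: real
  assumes "1 \<le> p" and "2 < L" and "0 < M"
  shows "\<exists>c>0. \<forall>(B :: ereal) (P :: (real^'d::finite) measure) (U :: (real^'s::finite) measure)
      (\<G> :: (real^'s \<Rightarrow> real^'d) set) (n :: nat) (Gh :: (nat \<Rightarrow> real^'d) \<Rightarrow> real^'s \<Rightarrow> real^'d).
    1 \<le> B \<longrightarrow>
    prob_on_cube p P \<longrightarrow>
    prob_on_cube p U \<longrightarrow>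
    \<G> \<noteq> {} \<longrightarrow>
    \<G> \<subseteq> meas_maps \<longrightarrow>
    sup_compact p \<G> \<longrightarrow>
    1 \<le> n \<longrightarrow>
    (CARD('s) = 2 \<longrightarrow> 2 \<le> n) \<longrightarrow>
    is_erm (lip_fun p L B) \<G> P U n Gh \<longrightarrow>
    (\<lambda>x. wass1 p P (gen_law U (Gh x))) \<in> borel_measurable (\<Pi>\<^sub>M i\<in>{..<n}. P) \<longrightarrow>
    (\<integral>x. wass1 p P (gen_law U (Gh x)) \<partial>(\<Pi>\<^sub>M i\<in>{..<n}. P))
      \<le> (INF Gs\<in>lip_maps p M.
            c * bracket (wass1 p P (gen_law U Gs)) + c * bracket (INF G\<in>\<G>. sup_dist p G Gs))
        + c * rate CARD('s) n"
proof -
  have "1 \<le> CARD('s)" by (simp add: Suc_le_eq)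
  from ex_chain_sum_le_rate[OF this] obtain C where C: "0 < C"
    and K: "\<And>n. 1 \<le> n \<Longrightarrow> (CARD('s) = 2 \<longrightarrow> 2 \<le> n) \<Longrightarrow> \<exists>K. chain_sum CARD('s) n K \<le> C * (rate CARD('s) n)\<^sup>2"
    by blast
  let ?D = "real CARD('d)"
  define c where "c = 3 * ?D * L * (3 * ?D + sqrt (2 * ?D * (M * real CARD('s)) * C) + 1)"
  have c0: "0 < c"
    unfolding c_def using assms C by (intro mult_pos_pos add_nonneg_pos add_nonneg_nonneg) auto
  show ?thesis
  proof (intro exI[of _ c] conjI allI impI c0)
    fix B :: ereal and P :: "(real^'d) measure" and U :: "(real^'s) measure"
      and \<G> :: "(real^'s \<Rightarrow> real^'d) set" and n :: nat
      and Gh :: "(nat \<Rightarrow> real^'d) \<Rightarrow> real^'s \<Rightarrow> real^'d"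
    assume B: "1 \<le> B" and "prob_on_cube p P" "prob_on_cube p U" and \<G>: "\<G> \<noteq> {}" "\<G> \<subseteq> meas_maps"
      and n: "1 \<le> n" "CARD('s) = 2 \<longrightarrow> 2 \<le> n" and erm: "is_erm (lip_fun p L B) \<G> P U n Gh"
    then have P: "cube_prob P" and U: "cube_prob U" by (auto simp: prob_on_cube_def cube_prob_def)
    let ?E = "\<integral>x. wass1 p P (gen_law U (Gh x)) \<partial>(\<Pi>\<^sub>M i\<in>{..<n}. P)"
    obtain K where K: "chain_sum CARD('s) n K \<le> C * (rate CARD('s) n)\<^sup>2" using K[OF n] by blast
    \<comment> \<open>Terms free of the infimum variable are moved to the left, so that a bound for
      every \<open>Gs\<close> is a bound for the infimum. The same device handles \<open>G\<close>
      below, under the root.\<close>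
    have "?E - c * rate CARD('s) n \<le> (INF Gs\<in>lip_maps p M.
        c * bracket (wass1 p P (gen_law U Gs)) + c * bracket (INF G\<in>\<G>. sup_dist p G Gs))"
    proof (rule cINF_greatest)
      show "lip_maps p M \<noteq> ({} :: (real^'s \<Rightarrow> real^'d) set)"
        using assms(3) by (intro lip_maps_nonempty) simp
      fix Gs :: "real^'s \<Rightarrow> real^'d" assume Gs: "Gs \<in> lip_maps p M"
      let ?w = "wass1 p P (gen_law U Gs)"
      have Gs_meas: "Gs \<in> cube_borel \<rightarrow>\<^sub>M cube_borel"
        using lip_maps_measurable[OF assms(1) _ Gs] assms(3) by simp
      have "?E - c * rate CARD('s) n - c * sqrt ?w \<le> c * sqrt (INF G\<in>\<G>. sup_dist p G Gs)"
      proof (rule le_sqrt_INF[OF \<G>(1) c0])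
        fix G assume G: "G \<in> \<G>"
        then have "G \<in> cube_borel \<rightarrow>\<^sub>M cube_borel" using \<G>(2) by (auto simp: meas_maps_def)
        then show "0 \<le> sup_dist p G Gs"
          using Gs_meas by (intro sup_dist_nonneg assms(1) measurable_cube_maps)
        have "?E \<le> c * sqrt ?w + c * sqrt (sup_dist p G Gs) + c * rate CARD('s) n"
          unfolding c_def
          using erm_expectation_bound[OF assms(1) _ assms(3) C B P U n(1) K rate_pos[OF n] \<G>(2) erm G Gs] assms(2)
          by simp
        then show "?E - c * rate CARD('s) n - c * sqrt ?w \<le> c * sqrt (sup_dist p G Gs)" by simp
      qed
      moreover have "c * sqrt ?w \<le> c * bracket ?w"
        "c * sqrt (INF G\<in>\<G>. sup_dist p G Gs) \<le> c * bracket (INF G\<in>\<G>. sup_dist p G Gs)"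
        using c0 sqrt_le_bracket by (auto intro!: mult_left_mono)
      ultimately show "?E - c * rate CARD('s) n
          \<le> c * bracket ?w + c * bracket (INF G\<in>\<G>. sup_dist p G Gs)" by linarith
    qed
    then show "?E \<le> (INF Gs\<in>lip_maps p M.
        c * bracket (wass1 p P (gen_law U Gs)) + c * bracket (INF G\<in>\<G>. sup_dist p G Gs))
        + c * rate CARD('s) n" by simp
  qed
qed

end
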